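(* Let $d\ge2$, $\mu>-\frac12$. For $\mathbf k\in\mathbb{N}_0^d$, $k=|\mathbf k|$ and $0\le k\le n$, the norm of $\mathsf{V}_{\mathbf k,n}$ is given by $$b_\mu\int_{\mathbb{V}^{d+1}}|\mathsf{V}_{\mathbf k,n}(x,t)|^2W_\mu(x,t)\,dx\,dt=\frac{(\frac{\mathbf 1}2)_{\mathbf k}}{(\mu+\frac{d+1}2)_k}\sum_{2\mathbf i\le\mathbf k}\sum_{m=0}^{|\mathbf i|}B_{\mathbf i,m}\,\bigl\|q_{n-k+2m}^{2(k-2m)+2\mu+d-1}\bigr\|^2\,\frac{(-k-\mu-\frac{d-1}2)_{|\mathbf i|}}{(-\mathbf k+\frac{\mathbf 1}{2})_{\mathbf i}},$$ where $$\bigl\|q_{n-j}^{2j+2\mu+d-1}\bigr\|^2=b_\mu^w\int_0^\infty\bigl|q_{n-j}^{2j+2\mu+d-1}(t)\bigr|^2t^{2j+2\mu+d-1}w(t)\,dt.$$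
   Context: Multi-index notation: for $\mathbf k,\mathbf j\in\mathbb{N}_0^d$, $\mathbf a\in\mathbb{R}^d$: $|\mathbf k|=k_1+\cdots+k_d$, $\mathbf k!=k_1!\cdots k_d!$, $x^{\mathbf k}=x_1^{k_1}\cdots x_d^{k_d}$, $(\mathbf a)_{\mathbf k}=(a_1)_{k_1}\cdots(a_d)_{k_d}$ with $(a)_k=a(a+1)\cdots(a+k-1)$, $\mathbf 1=(1,\dots,1)$; $2\mathbf j\le\mathbf k$ means $2j_i\le k_i$ for all $i$, and sums over such conditions run over $\mathbf j\in\mathbb{N}_0^d$. Put $\lambda=\mu+\frac{d-1}2$. $\mathbb{V}^{d+1}=\{(x,t)\in\mathbb{R}^{d+1}:\|x\|\le t,\ t\ge0\}$, $W_\mu(x,t)=w(t)(t^2-\|x\|^2)^{\mu-\frac12}$, where $w$ is a weight function on $\mathbb{R}_+=[0,\infty)$ (possibly supported on $[0,1]$): $w\ge0$ and $\int_0^\infty t^{d+2\mu-1+j}w(t)\,dt$ is finite and positive for all integers $j\ge0$. $b_\mu^w=\bigl(\int_0^\infty t^{d+2\mu-1}w(t)\,dt\bigr)^{-1}$ and $b_\mu=\bigl(\int_{\mathbb{V}^{d+1}}W_\mu\,dx\,dt\bigr)^{-1}$. $q_j^\alpha$ is the monic orthogonal polynomial of degree $j$ with respect to $t^\alpha w(t)$ on $\mathbb{R}_+$. The polynomials $V_{\mathbf k}$ on the ball are $$V_{\mathbf k}(x)=\sum_{2\mathbf j\le\mathbf k}b^\mu_{\mathbf k,\mathbf j}x^{\mathbf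 k-2\mathbf j},\qquad b^\mu_{\mathbf k,\mathbf j}=\frac{(-\frac{\mathbf k}2)_{\mathbf j}(\frac{-\mathbf k+\mathbf 1}2)_{\mathbf j}}{(-|\mathbf k|-\lambda+1)_{|\mathbf j|}\,\mathbf j!},$$ and $\mathsf{S}_{\mathbf k,n}(x,t)=q_{n-m}^{\alpha_m}(t)\,t^mV_{\mathbf k}(x/t)$ for $|\mathbf k|=m\le n$, $\alpha_m=2m+2\mu+d-1$. Then $\mathsf{V}_{\mathbf k,n}=\sum_{2\mathbf j\le\mathbf k}c^\mu_{\mathbf k,\mathbf j}\mathsf{S}_{\mathbf k-2\mathbf j,n}$ with $$c^\mu_{\mathbf k,\mathbf j}=\frac{(-1)^{|\mathbf j|}(-\frac{\mathbf k}2)_{\mathbf j}(\frac{-\mathbf k+\mathbf 1}2)_{\mathbf j}}{(-|\mathbf k|-\lambda+1)_{2|\mathbf j|}\,\mathbf j!}\bigl(2(-|\mathbf k|-\lambda+1)_{|\mathbf j|}-(-|\mathbf k|-\lambda)_{|\mathbf j|}\bigr).$$ Finally $$B_{\mathbf i,m}=\frac{(-1)^m\left(\frac{-\mathbf k}2\right)_{\mathbf i}\left(\frac{-\mathbf k+\mathbf 1}2\right)_{\mathbf i}}{(-|\mathbf k|-\lambda+1)_{|\mathbf i|+m}\,\mathbf i!}\binom{|\mathbf i|}{m}\bigl(2(-|\mathbf k|-\lambda+1)_m-(-|\mathbf k|-\lambda)_m\bigr).$$ *)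

theory Defs
  imports "HOL-Analysis.Analysis" "HOL-Computational_Algebra.Polynomial"
begin

text \<open>
  The dimension \<open>d\<close> is \<open>CARD('d)\<close>: points of \<open>\<real>\<^sup>d\<close> have type \<open>real ^ 'd\<close> and multi-indices have
  type \<open>'d \<Rightarrow> nat\<close>.  All integrals are Lebesgue integrals; values at \<open>t = 0\<close> and on the boundary
  of the cone, where \<open>powr\<close> and division follow their HOL conventions, concern null sets only.
\<close>

subsection \<open>Multi-indices\<close>

definition mabs :: "('d::finite \<Rightarrow> nat) \<Rightarrow> nat" where
  "mabs k = (\<Sum>i\<in>UNIV. k i)"

definition mfact :: "('d::finite \<Rightarrow> nat) \<Rightarrow> real" where
  "mfact k = (\<Prod>i\<in>UNIV. fact (k i))"

definition mpow :: "real ^ 'd::finite \<Rightarrow> ('d \<Rightarrow> nat) \<Rightarrow> real" where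
  "mpow x k = (\<Prod>i\<in>UNIV. (x $ i) ^ k i)"

definition mpoch :: "('d::finite \<Rightarrow> real) \<Rightarrow> ('d \<Rightarrow> nat) \<Rightarrow> real" where
  "mpoch a k = (\<Prod>i\<in>UNIV. pochhammer (a i) (k i))"

definition half_le :: "('d::finite \<Rightarrow> nat) \<Rightarrow> ('d \<Rightarrow> nat) set" where
  "half_le k = {j. \<forall>i. 2 * j i \<le> k i}"

definition lam :: "nat \<Rightarrow> real \<Rightarrow> real" where
  "lam d \<mu> = \<mu> + (real d - 1) / 2"

subsection \<open>Weights\<close>

definition is_weight :: "nat \<Rightarrow> real \<Rightarrow> (real \<Rightarrow> real) \<Rightarrow> bool" where
  "is_weight d \<mu> w \<longleftrightarrow>
     (\<forall>t\<ge>0. w t \<ge> 0) \<and>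
     (\<forall>j::nat. set_integrable lebesgue {0..} (\<lambda>t. t powr (real d + 2 * \<mu> - 1 + real j) * w t) \<and>
        (LINT t:{0..}|lebesgue. t powr (real d + 2 * \<mu> - 1 + real j) * w t) > 0)"

definition solid_cone :: "((real ^ 'd::finite) \<times> real) set" where
  "solid_cone = {(x, t). norm x \<le> t \<and> t \<ge> 0}"

definition cone_weight :: "(real \<Rightarrow> real) \<Rightarrow> real \<Rightarrow> (real ^ 'd::finite) \<times> real \<Rightarrow> real" where
  "cone_weight w \<mu> = (\<lambda>(x, t). w t * (t\<^sup>2 - (norm x)\<^sup>2) powr (\<mu> - 1/2))"

definition b_radial :: "nat \<Rightarrow> (real \<Rightarrow> real) \<Rightarrow> real \<Rightarrow> real" where
  "b_radial d w \<mu> = inverse (LINT t:{0..}|lebesgue. t powr (real d + 2 * \<mu> - 1) * w t)"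

definition b_cone :: "'d::finite itself \<Rightarrow> (real \<Rightarrow> real) \<Rightarrow> real \<Rightarrow> real" where
  "b_cone _ w \<mu> =
     inverse (LINT p:(solid_cone :: ((real ^ 'd) \<times> real) set)|lebesgue. cone_weight w \<mu> p)"

subsection \<open>Orthogonal polynomials\<close>

definition is_monic_op :: "(real \<Rightarrow> real) \<Rightarrow> real \<Rightarrow> nat \<Rightarrow> real poly \<Rightarrow> bool" where
  "is_monic_op w \<alpha> j p \<longleftrightarrow>
     degree p = j \<and> lead_coeff p = 1 \<and>
     (\<forall>r. degree r < j \<longrightarrow> (LINT t:{0..}|lebesgue. poly p t * poly r t * (t powr \<alpha> * w t)) = 0)"

text \<open>
  If \<open>is_weight d \<mu> w\<close> holds and \<open>\<alpha> = d + 2\<mu> - 1 + 2m\<close>, then all moments of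
  \<open>t\<^sup>\<alpha> w(t)\<close> are finite and \<open>p \<mapsto> \<integral> p\<^sup>2 t\<^sup>\<alpha> w(t) dt\<close> is positive
  definite, so the monic orthogonal polynomial of each degree exists and is unique.
\<close>

definition q_poly :: "(real \<Rightarrow> real) \<Rightarrow> nat \<Rightarrow> real \<Rightarrow> real poly" where
  "q_poly w j \<alpha> = (THE p. is_monic_op w \<alpha> j p)"

definition q_norm_sq :: "nat \<Rightarrow> (real \<Rightarrow> real) \<Rightarrow> real \<Rightarrow> nat \<Rightarrow> real \<Rightarrow> real" where
  "q_norm_sq d w \<mu> j \<alpha> =
     b_radial d w \<mu> * (LINT t:{0..}|lebesgue. \<bar>poly (q_poly w j \<alpha>) t\<bar>\<^sup>2 * t powr \<alpha> * w t)"

definition b_coeff :: "real \<Rightarrow> ('d::finite \<Rightarrow> nat) \<Rightarrow> ('d \<Rightarrow> nat) \<Rightarrow> real" where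
  "b_coeff \<mu> k j =
     mpoch (\<lambda>i. - real (k i) / 2) j * mpoch (\<lambda>i. (- real (k i) + 1) / 2) j /
     (pochhammer (- real (mabs k) - lam CARD('d) \<mu> + 1) (mabs j) * mfact j)"

definition V_ball :: "real \<Rightarrow> ('d::finite \<Rightarrow> nat) \<Rightarrow> real ^ 'd \<Rightarrow> real" where
  "V_ball \<mu> k x = (\<Sum>j\<in>half_le k. b_coeff \<mu> k j * mpow x (\<lambda>i. k i - 2 * j i))"

definition S_cone ::
  "(real \<Rightarrow> real) \<Rightarrow> real \<Rightarrow> ('d::finite \<Rightarrow> nat) \<Rightarrow> nat \<Rightarrow> (real ^ 'd) \<times> real \<Rightarrow> real" where
  "S_cone w \<mu> k n = (\<lambda>(x, t).
     poly (q_poly w (n - mabs k) (2 * real (mabs k) + 2 * \<mu> + real CARD('d) - 1)) t *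
     t ^ mabs k * V_ball \<mu> k (x /\<^sub>R t))"

definition c_coeff :: "real \<Rightarrow> ('d::finite \<Rightarrow> nat) \<Rightarrow> ('d \<Rightarrow> nat) \<Rightarrow> real" where
  "c_coeff \<mu> k j =
     (-1) ^ mabs j * mpoch (\<lambda>i. - real (k i) / 2) j * mpoch (\<lambda>i. (- real (k i) + 1) / 2) j /
     (pochhammer (- real (mabs k) - lam CARD('d) \<mu> + 1) (2 * mabs j) * mfact j) *
     (2 * pochhammer (- real (mabs k) - lam CARD('d) \<mu> + 1) (mabs j)
        - pochhammer (- real (mabs k) - lam CARD('d) \<mu>) (mabs j))"

definition V_cone ::
  "(real \<Rightarrow> real) \<Rightarrow> real \<Rightarrow> ('d::finite \<Rightarrow> nat) \<Rightarrow> nat \<Rightarrow> (real ^ 'd) \<times> real \<Rightarrow> real" where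
  "V_cone w \<mu> k n p =
     (\<Sum>j\<in>half_le k. c_coeff \<mu> k j * S_cone w \<mu> (\<lambda>i. k i - 2 * j i) n p)"

definition B_coeff :: "real \<Rightarrow> ('d::finite \<Rightarrow> nat) \<Rightarrow> ('d \<Rightarrow> nat) \<Rightarrow> nat \<Rightarrow> real" where
  "B_coeff \<mu> k i m =
     (-1) ^ m * mpoch (\<lambda>l. - real (k l) / 2) i * mpoch (\<lambda>l. (- real (k l) + 1) / 2) i /
     (pochhammer (- real (mabs k) - lam CARD('d) \<mu> + 1) (mabs i + m) * mfact i) *
     real (mabs i choose m) *
     (2 * pochhammer (- real (mabs k) - lam CARD('d) \<mu> + 1) m
        - pochhammer (- real (mabs k) - lam CARD('d) \<mu>) m)"

end

theory Submission
  imports Defs "HOL-Probability.Distributions"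
begin

text \<open>
  Put \<open>P\<^sub>m = \<Sum>\<^bsub>|j|=m\<^esub> c\<^bsub>k,j\<^esub> V\<^bsub>k-2j\<^esub>\<close>, a polynomial on the unit ball.  Writing a point of the cone as \<open>(t y, t)\<close>
  turns the norm of \<open>V\<^bsub>k,n\<^esub>\<close> into a sum over \<open>m, m'\<close> of a radial integral times \<open>\<langle>P\<^sub>m, P\<^bsub>m'\<^esub>\<rangle>\<close> on the ball.
  Expanding gives \<open>P\<^sub>m = \<Sum>\<^sub>i B\<^bsub>i,m\<^esub> x\<^bsup>k-2i\<^esup>\<close>, and \<open>\<Sum>\<^sub>m B\<^bsub>i,m\<^esub>\<close> vanishes unless \<open>i = 0\<close>, so \<open>\<Sum>\<^sub>m P\<^sub>m = x\<^sup>k\<close>.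
  As \<open>V\<^sub>l\<close> is orthogonal to all monomials of smaller degree, the \<open>P\<^sub>m\<close> are mutually orthogonal; hence they are
  the orthogonal components of \<open>x\<^sup>k\<close>, and \<open>\<langle>P\<^sub>m, P\<^sub>m\<rangle> = \<langle>P\<^sub>m, x\<^sup>k\<rangle>\<close> is a single sum of ball moments.  The
  orthogonality of the radial polynomials plays no role.
\<close>

section \<open>Finite differences and multi-index sums\<close>

text \<open>The obstacle is that the coefficients of \<open>V_ball\<close> do not split over the
  coordinates: their denominators and the ball moments contain Pochhammer symbols in the total
  degree |j|. Against a monomial of lower degree, the reciprocal of these symbols turns out to be
  (-1)^|j| times a polynomial in |j|. Expanding it in binomials (|j| choose e) and spreading each
  over the coordinates by Vandermonde's identity leaves products of one-variable sums, each product
  with a vanishing factor. Orthogonality thus becomes a fact about finite differences, settled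
  before any integral appears. The same identity produces the factor (|i| choose m) of
  \<open>B_coeff\<close>. With c = -|k| - lambda, the factor 2(c+1)_m - (c)_m equals (c+1)_m
  (c+2m)/(c+m); the numerator c+2m makes the sum over m telescope. On the analytic side, the weight
  is known only through Lebesgue integrable functions t^a w(t), while Fubini's theorem is applied to
  Borel functions, so the radial integrand is first exchanged for a Borel version.\<close>

lemma alternating_binomial_poly_sum:
  fixes h :: "real poly"
  assumes "degree h < s"
  shows "(\<Sum>j\<le>s. (-1) ^ j * real (s choose j) * poly h (real j)) = 0"
  using assms
proof (induction s arbitrary: h)
  case (Suc s)
  \<comment> \<open>Pascal's rule turns the sum of order s+1 for \<open>h\<close> into the sum of
    order s for the difference \<open>g\<close>, in which the leading terms cancel. A constant
    \<open>h\<close> gives \<open>g = 0\<close>, hence the case distinction below.\<close>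
  define g where "g = h - pcompose h [:1, 1:]"
  have g: "poly g x = poly h x - poly h (x + 1)" for x
    by (simp add: g_def poly_pcompose add.commute)
  have "degree g \<le> degree h"
    unfolding g_def by (rule degree_diff_le) (simp_all add: degree_pcompose)
  moreover have "coeff g (degree h) = 0"
    using lead_coeff_comp[of "[:1, 1:]" h] by (simp add: g_def degree_pcompose)
  ultimately have "g = 0 \<or> degree g < degree h"
    by (rule eq_zero_or_degree_less)
  then have g0: "(\<Sum>j\<le>s. (-1) ^ j * real (s choose j) * poly g (real j)) = 0"
    using Suc by auto
  have "(\<Sum>j\<le>Suc s. (-1) ^ j * real (Suc s choose j) * poly h (real j))
      = poly h 0 + (\<Sum>j\<le>s. (-1) ^ Suc j * real (Suc s choose Suc j) * poly h (real (Suc j)))"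
    by (subst sum.atMost_Suc_shift) simp
  also have "\<dots> = poly h 0 + (\<Sum>j\<le>s. (-1) ^ Suc j * real (s choose Suc j) * poly h (real (Suc j)))
      + (\<Sum>j\<le>s. (-1) ^ Suc j * real (s choose j) * poly h (real (Suc j)))"
    by (simp add: sum.distrib[symmetric] algebra_simps)
  also have "poly h 0 + (\<Sum>j\<le>s. (-1) ^ Suc j * real (s choose Suc j) * poly h (real (Suc j)))
      = (\<Sum>j\<le>Suc s. (-1) ^ j * real (s choose j) * poly h (real j))"
    by (subst sum.atMost_Suc_shift) simp
  also have "\<dots> = (\<Sum>j\<le>s. (-1) ^ j * real (s choose j) * poly h (real j))"
    by simp
  also have "\<dots> + (\<Sum>j\<le>s. (-1) ^ Suc j * real (s choose j) * poly h (real (Suc j)))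
      = (\<Sum>j\<le>s. (-1) ^ j * real (s choose j) * poly g (real j))"
    by (simp add: sum.distrib[symmetric] g algebra_simps)
  finally show ?case using g0 by simp
qed simp

lemma finite_bounded_multi_index: "finite {j :: 'd::finite \<Rightarrow> nat. \<forall>i. j i \<le> b i}"
proof -
  have "{j :: 'd \<Rightarrow> nat. \<forall>i. j i \<le> b i} = (\<Pi>\<^sub>E i\<in>UNIV. {..b i})"
    by (auto simp: PiE_def Pi_def)
  then show ?thesis by (simp add: finite_PiE)
qed

lemma prod_sum_multi_index:
  fixes f :: "'d::finite \<Rightarrow> nat \<Rightarrow> 'c::comm_semiring_1"
  assumes "\<And>i. finite (B i)"
  shows "(\<Sum>j | \<forall>i. j i \<in> B i. \<Prod>i\<in>UNIV. f i (j i)) = (\<Prod>i\<in>UNIV. \<Sum>y\<in>B i. f i y)"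
proof -
  have "{j. \<forall>i. j i \<in> B i} = (\<Pi>\<^sub>E i\<in>UNIV. B i)" by (auto simp: PiE_def Pi_def)
  then show ?thesis using assms by (simp add: prod_sum_PiE)
qed

lemma finite_half_le: "finite (half_le k)"
proof -
  have "half_le k \<subseteq> {j. \<forall>i. j i \<le> k i}"
    unfolding half_le_def by (rule Collect_mono, rule impI, rule allI) (metis le_add2 mult_2 order_trans)
  then show ?thesis by (rule finite_subset[OF _ finite_bounded_multi_index])
qed

lemma finite_mabs_eq: "finite {j :: 'd::finite \<Rightarrow> nat. mabs j = e}"
proof -
  have "j i \<le> e" if "mabs j = e" for j :: "'d \<Rightarrow> nat" and i
    using that member_le_sum[of i UNIV j] unfolding mabs_def by simp
  then have "{j :: 'd \<Rightarrow> nat. mabs j = e} \<subseteq> {j. \<forall>i. j i \<le> e}"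
    by blast
  then show ?thesis by (rule finite_subset[OF _ finite_bounded_multi_index])
qed

text \<open>Compare the coefficients of X^e in the product of the (1+X)^(n i) and in
  (1+X)^|n|.\<close>

lemma multi_index_Vandermonde_le:
  fixes n :: "'d::finite \<Rightarrow> nat"
  shows "(\<Sum>j | (\<forall>i. j i \<le> n i) \<and> mabs j = e. \<Prod>i\<in>UNIV. n i choose j i) = mabs n choose e"
proof -
  have one: "(\<Sum>y\<le>m. monom (m choose y) y) = [:1, 1::nat:] ^ m" for m
  proof -
    have "[:1, 1::nat:] ^ m = ([:0, 1:] + 1) ^ m" by (simp add: one_pCons)
    also have "\<dots> = (\<Sum>y\<le>m. of_nat (m choose y) * [:0, 1:] ^ y)"
      by (simp add: binomial_ring)
    also have "\<dots> = (\<Sum>y\<le>m. monom (m choose y) y)"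
      by (intro sum.cong refl) (simp add: monom_altdef of_nat_poly)
    finally show ?thesis ..
  qed
  have "(\<Sum>j | \<forall>i. j i \<le> n i. monom (\<Prod>i\<in>UNIV. n i choose j i) (mabs j))
      = (\<Sum>j | \<forall>i. j i \<in> {..n i}. \<Prod>i\<in>UNIV. monom (n i choose j i) (j i))"
  proof -
    have "monom (\<Prod>i\<in>A. f i) (\<Sum>i\<in>A. g i) = (\<Prod>i\<in>A. monom (f i) (g i))"
      if "finite A" for A :: "'d set" and f g :: "'d \<Rightarrow> nat"
      using that
    proof (induction A rule: finite_induct)
      case (insert x F)
      have "monom (f x * prod f F) (g x + sum g F) = monom (f x) (g x) * monom (prod f F) (sum g F)"
        by (simp add: mult_monom)
      then show ?case using insert by simp
    qed (simp add: monom_eq_1 flip: One_nat_def)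
    then show ?thesis by (simp add: mabs_def)
  qed
  also have "\<dots> = (\<Prod>i\<in>UNIV. [:1, 1:] ^ n i)"
    by (subst prod_sum_multi_index) (simp_all add: one)
  also have "\<dots> = [:1, 1:] ^ mabs n"
    by (simp add: mabs_def power_sum)
  finally have "coeff (\<Sum>j | \<forall>i. j i \<le> n i. monom (\<Prod>i\<in>UNIV. n i choose j i) (mabs j)) e
      = coeff ([:1, 1:] ^ mabs n) e" by simp
  moreover have "coeff ([:1, 1:] ^ mabs n) e = mabs n choose e"
    unfolding one[symmetric] by (simp add: coeff_sum sum.delta binomial_eq_0)
  moreover have "coeff (\<Sum>j | \<forall>i. j i \<le> n i. monom (\<Prod>i\<in>UNIV. n i choose j i) (mabs j)) e
    = (\<Sum>j | (\<forall>i. j i \<le> n i) \<and> mabs j = e. \<Prod>i\<in>UNIV. n i choose j i)"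
    by (simp add: coeff_sum sum.If_cases finite_bounded_multi_index Int_def)
  ultimately show ?thesis by simp
qed

lemma multi_index_Vandermonde:
  fixes n :: "'d::finite \<Rightarrow> nat"
  shows "(\<Sum>j | mabs j = e. \<Prod>i\<in>UNIV. n i choose j i) = mabs n choose e"
proof -
  have "(\<Sum>j | mabs j = e. \<Prod>i\<in>UNIV. n i choose j i)
      = (\<Sum>j | (\<forall>i. j i \<le> n i) \<and> mabs j = e. \<Prod>i\<in>UNIV. n i choose j i)"
    by (intro sum.mono_neutral_right finite_mabs_eq) (auto simp: not_le binomial_eq_0)
  then show ?thesis by (simp add: multi_index_Vandermonde_le)
qed

section \<open>Pochhammer symbols\<close>

text \<open>The factors of the two symbols interleave to k(k-1)...(k-2j+1) / 4^j; the 2j minus signs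
  cancel.\<close>

lemma pochhammer_halves:
  assumes "2 * j \<le> k"
  shows "pochhammer (- real k / 2) j * pochhammer ((- real k + 1) / 2) j
    = fact k / (4 ^ j * fact (k - 2 * j))"
  using assms
proof (induction j)
  case (Suc j)
  define r where "r = k - 2 * Suc j"
  have r: "k = Suc (Suc (r + 2 * j))" using Suc.prems by (simp add: r_def)
  have "fact (k - 2 * j) = (real r + 2) * (real r + 1) * fact r"
    by (simp add: r algebra_simps)
  moreover have "(- real k / 2 + j) * ((- real k + 1) / 2 + j) = (real r + 2) * (real r + 1) / 4"
    by (simp add: r field_simps)
  moreover have "pochhammer (- real k / 2) (Suc j) * pochhammer ((- real k + 1) / 2) (Suc j)
     = (pochhammer (- real k / 2) j * pochhammer ((- real k + 1) / 2) j)
       * ((- real k / 2 + j) * ((- real k + 1) / 2 + j))"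
    by (simp only: pochhammer_Suc mult_ac)
  moreover have "pochhammer (- real k / 2) j * pochhammer ((- real k + 1) / 2) j
      = fact k / (4 ^ j * fact (k - 2 * j))"
    using Suc by simp
  ultimately have "pochhammer (- real k / 2) (Suc j) * pochhammer ((- real k + 1) / 2) (Suc j)
     = fact k / (4 ^ j * ((real r + 2) * (real r + 1) * fact r)) * ((real r + 2) * (real r + 1) / 4)"
    by (simp only:)
  moreover have "(real r + 2) * (real r + 1) \<noteq> 0" by simp
  ultimately show ?case unfolding r_def[symmetric] by simp
qed simp

lemma pochhammer_one_half: "pochhammer (1 / 2 :: real) n = fact (2 * n) / (4 ^ n * fact n)"
  by (simp add: fact_double pochhammer_fact[symmetric] power_mult)

text \<open>The classical computation behind the orthogonality of Legendre polynomials: the weight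
  times the factorial quotient is a polynomial of degree \<open>l\<close> in \<open>j\<close> against the
  alternating binomials of \<open>s = (k + l) / 2\<close>.\<close>

lemma moment_sum_eq_0:
  fixes k l s e :: nat
  assumes s: "2 * s = k + l" and e: "e + l < s"
  shows "(\<Sum>j | 2 * j \<le> k. (-1) ^ j * pochhammer (- real k / 2) j * pochhammer ((- real k + 1) / 2) j
     / fact j * pochhammer (1 / 2) (s - j) * real (j choose e)) = 0"
proof -
  \<comment> \<open>\<open>P\<close> interpolates (2(s-j))! / (k-2j)! = (k-2j+1)...(k-2j+l), which
    comes from the moment and the coefficient together; \<open>Q\<close> is (j choose e) as a
    polynomial in j. The degrees l and e account for the hypothesis
    \<open>e + l < s\<close>.\<close>
  define P :: "real poly" where "P = (\<Prod>r<l. [:real k + 1 + real r, -2:])"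
  define Q :: "real poly" where "Q = smult (1 / fact e) (\<Prod>r<e. [:- real r, 1:])"
  have "degree (\<Prod>r<m. [:f r, c:]) \<le> m" for f :: "nat \<Rightarrow> real" and c m
    using degree_prod_sum_le[of "{..<m}" "\<lambda>r. [:f r, c:]"]
      sum_mono[of "{..<m}" "\<lambda>r. degree [:f r, c:]" "\<lambda>_. 1"] by (simp add: degree_pCons_le order_trans)
  then have "degree P \<le> l" "degree Q \<le> e"
    unfolding P_def Q_def by (auto intro: order_trans[OF degree_smult_le])
  then have "degree (P * Q) < s"
    using e degree_mult_le[of P Q] by linarith
  have polyP: "poly P (real j) = (\<Prod>r<l. real k - 2 * real j + 1 + real r)" for j
    by (simp add: P_def poly_prod algebra_simps)
  \<comment> \<open>For k < 2j <= 2s one of the l factors is zero. The sum over 2j <= k may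
    therefore be extended to all j <= s, as the finite difference requires.\<close>
  have P0: "poly P (real j) = 0" if "k < 2 * j" "j \<le> s" for j
  proof -
    have "2 * j - k - 1 < l" "real k - 2 * real j + 1 + real (2 * j - k - 1) = 0"
      using that s by auto
    then show ?thesis unfolding polyP by (intro prod_zero) auto
  qed
  have polyQ: "poly Q (real j) = real (j choose e)" for j
    by (simp add: Q_def poly_prod binomial_gbinomial gbinomial_prod_rev lessThan_atLeast0)
  have summand: "(-1) ^ j * pochhammer (- real k / 2) j * pochhammer ((- real k + 1) / 2) j
     / fact j * pochhammer (1 / 2) (s - j) * real (j choose e)
     = fact k / (4 ^ s * fact s) * ((-1) ^ j * real (s choose j) * poly (P * Q) (real j))"
    if j: "2 * j \<le> k" for j
  proof -
    have js: "j \<le> s" using j s by linarith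
    have "fact (2 * (s - j)) = (fact (k - 2 * j) * pochhammer (real (k - 2 * j) + 1) l :: real)"
    proof -
      have "2 * (s - j) = k - 2 * j + l" using j s by linarith
      then show ?thesis
        using pochhammer_product'[of 1 "k - 2 * j" l]
        by (simp add: pochhammer_fact[where 'a = real] add.commute)
    qed
    moreover have "pochhammer (real (k - 2 * j) + 1) l = poly P (real j)"
      using j by (simp add: polyP pochhammer_prod lessThan_atLeast0 of_nat_diff)
    ultimately have A: "fact (2 * (s - j)) = fact (k - 2 * j) * poly P (real j)" by simp
    have B: "(4::real) ^ s = 4 ^ j * 4 ^ (s - j)" using js by (simp flip: power_add)
    have C: "real (s choose j) = fact s / (fact j * fact (s - j))"
      using js by (simp add: binomial_fact)
    have "(-1) ^ j * pochhammer (- real k / 2) j * pochhammer ((- real k + 1) / 2) j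
     / fact j * pochhammer (1 / 2) (s - j) * real (j choose e)
     = (-1) ^ j * (fact k / (4 ^ j * fact (k - 2 * j))) / fact j *
       (fact (2 * (s - j)) / (4 ^ (s - j) * fact (s - j))) * real (j choose e)"
      unfolding pochhammer_one_half pochhammer_halves[OF j, symmetric] by (simp only: mult.assoc)
    also have "\<dots> = fact k / (4 ^ s * fact s) * ((-1) ^ j * real (s choose j) * poly (P * Q) (real j))"
      unfolding A B C poly_mult polyQ by (simp add: field_simps)
    finally show ?thesis .
  qed
  have "(\<Sum>j | 2 * j \<le> k. (-1) ^ j * pochhammer (- real k / 2) j * pochhammer ((- real k + 1) / 2) j
     / fact j * pochhammer (1 / 2) (s - j) * real (j choose e))
    = (\<Sum>j | 2 * j \<le> k. fact k / (4 ^ s * fact s) * ((-1) ^ j * real (s choose j) * poly (P * Q) (real j)))"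
    using summand by (intro sum.cong) auto
  also have "\<dots> = (\<Sum>j\<le>s. fact k / (4 ^ s * fact s) * ((-1) ^ j * real (s choose j) * poly (P * Q) (real j)))"
    using s P0 by (intro sum.mono_neutral_left) auto
  also have "\<dots> = 0"
    using alternating_binomial_poly_sum[OF \<open>degree (P * Q) < s\<close>] by (simp only: sum_distrib_left[symmetric])
  finally show ?thesis .
qed

text \<open>Chu-Vandermonde for the binomial (x+J choose N). It writes a Pochhammer symbol shifted
  by J in the basis (J choose e), the only form in which a dependence on J = |j| can be distributed
  over the coordinates.\<close>

lemma pochhammer_add_nat_Vandermonde:
  fixes x :: real
  shows "pochhammer (- x - real J) N
    = (-1) ^ N * fact N * (\<Sum>e\<le>N. real (J choose e) * (x gchoose (N - e)))"
proof -
  have "(x + real J gchoose N) = (\<Sum>e\<le>N. real (J choose e) * (x gchoose (N - e)))"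
    using gbinomial_Vandermonde[of "real J" x N]
    by (simp add: add.commute binomial_gbinomial atLeast0AtMost)
  moreover have "pochhammer (- x - real J) N = (-1) ^ N * fact N * (x + real J gchoose N)"
    by (simp add: gbinomial_pochhammer)
  ultimately show ?thesis by simp
qed

lemma pochhammer_pos_neq_0: "x > 0 \<Longrightarrow> pochhammer (x::real) n \<noteq> 0"
  using pochhammer_pos[of x n] by simp

text \<open>Read backwards and negated, the J factors on the left are the last J factors of (L)_K.
  This gives the nonvanishing of the denominators, the orthogonality and the closed form of the
  final moments.\<close>

lemma pochhammer_reflect:
  fixes L :: real
  assumes "J \<le> K"
  shows "pochhammer (- real K - L + 1) J * pochhammer L (K - J) = (-1) ^ J * pochhammer L K"
proof -
  have "pochhammer (- real K - L + 1) J = (-1) ^ J * pochhammer (L + real (K - J)) J"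
    using assms pochhammer_minus[of "real K + L - 1" J] by (simp add: of_nat_diff algebra_simps)
  moreover have "pochhammer L K = pochhammer L (K - J) * pochhammer (L + real (K - J)) J"
    using assms pochhammer_product'[of L "K - J" J] by simp
  ultimately show ?thesis by simp
qed

text \<open>Covers the denominators of \<open>b_coeff\<close>, \<open>c_coeff\<close> and
  \<open>B_coeff\<close>: their lengths |j|, 2|j| and |i|+m are at most |k|. For J = K > 0 the last
  factor is -L, which is where positivity of lambda enters.\<close>

lemma pochhammer_neg_neq_0:
  fixes L :: real
  assumes "L > 0" "J \<le> K"
  shows "pochhammer (- real K - L + 1) J \<noteq> 0"
proof
  assume "pochhammer (- real K - L + 1) J = 0"
  then have "(-1) ^ J * pochhammer L K = 0" using pochhammer_reflect[OF assms(2), of L] by simp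
  then show False using pochhammer_pos_neq_0[OF assms(1), of K] by simp
qed

section \<open>Orthogonality at the level of moments\<close>

text \<open>The moment of x^a for the ball weight divided by the total mass, with L standing for
  lambda. Introducing it as a formula keeps the orthogonality purely algebraic;
  \<open>ball_integral_mpow\<close> links it to the integral.\<close>

definition ball_moment :: "real \<Rightarrow> ('d::finite \<Rightarrow> nat) \<Rightarrow> real" where
  "ball_moment L a = (if \<forall>i. even (a i)
     then mpoch (\<lambda>_. 1 / 2) (\<lambda>i. a i div 2) / pochhammer (L + 1) (mabs a div 2) else 0)"

lemma mabs_diff: "(\<And>i. b i \<le> a i) \<Longrightarrow> mabs (\<lambda>i. a i - b i) = mabs a - mabs b"
  by (simp add: mabs_def sum_subtractf_nat)

lemma mabs_double: "mabs (\<lambda>i. 2 * a i) = 2 * mabs a"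
  by (simp add: mabs_def sum_distrib_left)

lemma mabs_mono: "(\<And>i. a i \<le> b i) \<Longrightarrow> mabs a \<le> mabs b"
  by (simp add: mabs_def sum_mono)

lemma half_le_mabs: "j \<in> half_le k \<Longrightarrow> 2 * mabs j \<le> mabs k"
  unfolding mabs_double[symmetric] by (rule mabs_mono) (simp add: half_le_def)

lemma mabs_minus_double: "j \<in> half_le k \<Longrightarrow> mabs (\<lambda>i. k i - 2 * j i) = mabs k - 2 * mabs j"
  by (simp add: mabs_diff half_le_def mabs_double)

text \<open>The denominators of coefficient and moment combine to (-1)^J times a polynomial in J =
  |j| of degree N. Its expansion in (J choose e), followed by Vandermonde over the coordinates,
  gives products of sums as in \<open>moment_sum_eq_0\<close>. A pigeonhole argument then finds a
  coordinate in which that lemma applies.\<close>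

lemma ball_moment_orthogonal_even:
  fixes k l s :: "'d::finite \<Rightarrow> nat" and \<mu> :: real
  defines "L \<equiv> lam CARD('d) \<mu>"
  assumes L: "L > 0" and lk: "mabs l < mabs k" and s: "\<And>i. 2 * s i = k i + l i"
  shows "(\<Sum>j\<in>half_le k. b_coeff \<mu> k j * ball_moment L (\<lambda>i. k i - 2 * j i + l i)) = 0"
proof -
  define K where "K = mabs k"
  define S where "S = mabs s"
  \<comment> \<open>From 2S = |k| + |l| follows N + |l| = S - 1, just below S; the pigeonhole
    argument rests on this.\<close>
  define N where "N = K - S - 1"
  define f where "f i y = (-1) ^ y * pochhammer (- real (k i) / 2) y
    * pochhammer ((- real (k i) + 1) / 2) y / fact y * pochhammer (1 / 2) (s i - y)" for i y
  define C where "C e = (-1) ^ N * fact N * ((- (L + 1 + real S)) gchoose (N - e)) / pochhammer (L + 1) (K - 1)" for e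
  have S2: "2 * S = K + mabs l"
    unfolding S_def K_def mabs_double[symmetric] using s by (simp add: mabs_def sum.distrib)
  then have SK: "S < K" using lk by (simp add: K_def)
  have summand: "b_coeff \<mu> k j * ball_moment L (\<lambda>i. k i - 2 * j i + l i)
     = (\<Sum>e\<le>N. C e * (\<Sum>\<epsilon> | mabs \<epsilon> = e. \<Prod>i\<in>UNIV. f i (j i) * real (j i choose \<epsilon> i)))"
    if j: "j \<in> half_le k" for j
  proof -
    define J where "J = mabs j"
    have j': "2 * j i \<le> k i" for i using j by (simp add: half_le_def)
    have js: "j i \<le> s i" for i using j'[of i] s[of i] by linarith
    have JS: "J \<le> S" unfolding J_def S_def using js by (rule mabs_mono)
    have ev: "k i - 2 * j i + l i = 2 * (s i - j i)" for i using j'[of i] s[of i] by linarith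
    have mom: "ball_moment L (\<lambda>i. k i - 2 * j i + l i)
       = (\<Prod>i\<in>UNIV. pochhammer (1 / 2) (s i - j i)) / pochhammer (L + 1) (S - J)"
      by (simp add: ball_moment_def ev mpoch_def mabs_double mabs_diff js S_def J_def)
    have "pochhammer (- real K - L + 1) J * pochhammer L (K - J) = (-1) ^ J * pochhammer L K"
      using JS SK by (intro pochhammer_reflect) simp
    moreover have "pochhammer L (K - J) = L * pochhammer (L + 1) (K - 1 - J)"
      using pochhammer_rec[of L "K - 1 - J"] JS SK by (simp add: Suc_diff_Suc)
    moreover have "pochhammer L K = L * pochhammer (L + 1) (K - 1)"
      using pochhammer_rec[of L "K - 1"] SK by simp
    moreover have "pochhammer (L + 1) (K - 1 - J)
        = pochhammer (L + 1) (S - J) * pochhammer (L + 1 + real (S - J)) N"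
      using pochhammer_product'[of "L + 1" "S - J" N] JS SK by (simp add: N_def)
    ultimately have "pochhammer (- real K - L + 1) J * pochhammer (L + 1) (S - J)
        * pochhammer (L + 1 + real (S - J)) N = (-1) ^ J * pochhammer (L + 1) (K - 1)"
      using L by (simp add: mult_ac)
    moreover have "pochhammer (L + 1) (K - 1) \<noteq> 0" "pochhammer (L + 1) (S - J) \<noteq> 0"
      using L by (simp_all add: pochhammer_pos_neq_0)
    moreover have "pochhammer (- real K - L + 1) J \<noteq> 0"
      using L JS SK by (intro pochhammer_neg_neq_0) auto
    moreover have "((-1)::real) ^ J * (-1) ^ J = 1" by (simp flip: power_mult_distrib)
    \<comment> \<open>Reflection moves (1-K-L)_J into the numerator as (L+1)_(K-1-J), up to sign and
      a constant. Since K-1-J = (S-J) + N, the moment denominator cancels and only N factors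
      depending on J remain.\<close>
    ultimately have den: "1 / (pochhammer (- real K - L + 1) J * pochhammer (L + 1) (S - J))
        = (-1) ^ J * pochhammer (L + 1 + real (S - J)) N / pochhammer (L + 1) (K - 1)"
      by (simp add: field_simps)
    have "pochhammer (L + 1 + real (S - J)) N
       = (-1) ^ N * fact N * (\<Sum>e\<le>N. real (J choose e) * ((- (L + 1 + real S)) gchoose (N - e)))"
      using pochhammer_add_nat_Vandermonde[of "- (L + 1 + real S)" J N] JS
      by (simp add: of_nat_diff algebra_simps)
    then have vand: "pochhammer (L + 1 + real (S - J)) N / pochhammer (L + 1) (K - 1)
       = (\<Sum>e\<le>N. C e * real (J choose e))"
      by (simp add: C_def sum_distrib_left sum_divide_distrib mult_ac)
    have sgn: "(-1) ^ J = (\<Prod>i\<in>UNIV. (-1 :: real) ^ j i)"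
      by (simp add: J_def mabs_def power_sum)
    have "b_coeff \<mu> k j * ball_moment L (\<lambda>i. k i - 2 * j i + l i)
       = mpoch (\<lambda>i. - real (k i) / 2) j * mpoch (\<lambda>i. (- real (k i) + 1) / 2) j / mfact j *
         (\<Prod>i\<in>UNIV. pochhammer (1 / 2) (s i - j i))
         * (1 / (pochhammer (- real K - L + 1) J * pochhammer (L + 1) (S - J)))"
      unfolding b_coeff_def mom by (simp add: K_def J_def L_def)
    also have "\<dots> = (mpoch (\<lambda>i. - real (k i) / 2) j * mpoch (\<lambda>i. (- real (k i) + 1) / 2) j / mfact j *
         (\<Prod>i\<in>UNIV. pochhammer (1 / 2) (s i - j i)) * (-1) ^ J)
         * (pochhammer (L + 1 + real (S - J)) N / pochhammer (L + 1) (K - 1))"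
      unfolding den by simp
    also have "mpoch (\<lambda>i. - real (k i) / 2) j * mpoch (\<lambda>i. (- real (k i) + 1) / 2) j / mfact j *
         (\<Prod>i\<in>UNIV. pochhammer (1 / 2) (s i - j i)) * (-1) ^ J = (\<Prod>i\<in>UNIV. f i (j i))"
      unfolding f_def sgn mpoch_def mfact_def prod.distrib prod_dividef by (simp add: mult_ac)
    also have "(\<Prod>i\<in>UNIV. f i (j i)) * (pochhammer (L + 1 + real (S - J)) N / pochhammer (L + 1) (K - 1))
      = (\<Sum>e\<le>N. C e * ((\<Prod>i\<in>UNIV. f i (j i)) * real (J choose e)))"
      unfolding vand by (simp add: sum_distrib_left mult_ac)
    also have "\<dots> = (\<Sum>e\<le>N. C e * (\<Sum>\<epsilon> | mabs \<epsilon> = e. \<Prod>i\<in>UNIV. f i (j i) * real (j i choose \<epsilon> i)))"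
      unfolding J_def multi_index_Vandermonde[symmetric]
      by (simp add: prod.distrib sum_distrib_left)
    finally show ?thesis .
  qed
  have zero: "(\<Sum>j\<in>half_le k. \<Prod>i\<in>UNIV. f i (j i) * real (j i choose \<epsilon> i)) = 0"
    if \<epsilon>: "mabs \<epsilon> \<le> N" for \<epsilon>
  proof -
    \<comment> \<open>Otherwise summation over the coordinates would give S <= |\<epsilon>| + |l| <=
      N + |l| = S - 1.\<close>
    have "\<exists>i. \<epsilon> i + l i < s i"
    proof (rule ccontr)
      assume "\<nexists>i. \<epsilon> i + l i < s i"
      then have "mabs s \<le> mabs (\<lambda>i. \<epsilon> i + l i)" by (intro mabs_mono) (simp add: not_less)
      then have "S \<le> mabs \<epsilon> + mabs l" by (simp add: S_def mabs_def sum.distrib)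
      then show False using \<epsilon> S2 SK by (simp add: N_def)
    qed
    then obtain i0 where i0: "\<epsilon> i0 + l i0 < s i0" ..
    have fin: "finite {y. 2 * y \<le> k i}" for i
      by (rule finite_subset[of _ "{..k i}"]) auto
    have "(\<Sum>j\<in>half_le k. \<Prod>i\<in>UNIV. f i (j i) * real (j i choose \<epsilon> i))
       = (\<Sum>j | \<forall>i. j i \<in> {y. 2 * y \<le> k i}. \<Prod>i\<in>UNIV. f i (j i) * real (j i choose \<epsilon> i))"
      by (simp add: half_le_def)
    also have "\<dots> = (\<Prod>i\<in>UNIV. \<Sum>y | 2 * y \<le> k i. f i y * real (y choose \<epsilon> i))"
      by (rule prod_sum_multi_index) (rule fin)
    also have "\<dots> = 0"
      using moment_sum_eq_0[OF s i0] by (intro prod_zero bexI[of _ i0]) (simp_all add: f_def)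
    finally show ?thesis .
  qed
  have "(\<Sum>j\<in>half_le k. b_coeff \<mu> k j * ball_moment L (\<lambda>i. k i - 2 * j i + l i))
     = (\<Sum>j\<in>half_le k. \<Sum>e\<le>N. C e * (\<Sum>\<epsilon> | mabs \<epsilon> = e. \<Prod>i\<in>UNIV. f i (j i) * real (j i choose \<epsilon> i)))"
    using summand by (rule sum.cong[OF refl])
  also have "\<dots> = (\<Sum>e\<le>N. C e * (\<Sum>\<epsilon> | mabs \<epsilon> = e. \<Sum>j\<in>half_le k. \<Prod>i\<in>UNIV. f i (j i) * real (j i choose \<epsilon> i)))"
    by (subst sum.swap, subst sum.swap[of _ "half_le k"]) (simp add: sum_distrib_left)
  also have "\<dots> = 0" by (intro sum.neutral ballI) (auto simp: zero intro!: sum.neutral)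
  finally show ?thesis .
qed

lemma ball_moment_orthogonal:
  fixes k l :: "'d::finite \<Rightarrow> nat" and \<mu> :: real
  assumes L: "lam CARD('d) \<mu> > 0" and lk: "mabs l < mabs k"
  shows "(\<Sum>j\<in>half_le k. b_coeff \<mu> k j * ball_moment (lam CARD('d) \<mu>) (\<lambda>i. k i - 2 * j i + l i)) = 0"
proof (cases "\<forall>i. even (k i + l i)")
  case True
  then have "2 * ((k i + l i) div 2) = k i + l i" for i by simp
  then show ?thesis by (rule ball_moment_orthogonal_even[OF L lk])
next
  case False
  then obtain i where i: "odd (k i + l i)" by auto
  have "ball_moment (lam CARD('d) \<mu>) (\<lambda>i. k i - 2 * j i + l i) = 0" if "j \<in> half_le k" for j
  proof -
    have "2 * j i \<le> k i" using that by (simp add: half_le_def)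
    then have "odd (k i - 2 * j i + l i)" using i by simp
    then show ?thesis unfolding ball_moment_def by auto
  qed
  then show ?thesis by simp
qed

section \<open>The components of a monomial\<close>

lemma mpoch_split:
  assumes "\<And>x. j x \<le> i x"
  shows "mpoch a j * mpoch (\<lambda>x. a x + real (j x)) (\<lambda>x. i x - j x) = mpoch a i"
  unfolding mpoch_def prod.distrib[symmetric]
proof (rule prod.cong[OF refl])
  fix x show "pochhammer (a x) (j x) * pochhammer (a x + real (j x)) (i x - j x) = pochhammer (a x) (i x)"
    using pochhammer_product'[of "a x" "j x" "i x - j x"] assms[of x] by simp
qed

lemma mfact_split:
  assumes "\<And>x. j x \<le> i x"
  shows "mfact i = mfact j * mfact (\<lambda>x. i x - j x) * real (\<Prod>x\<in>UNIV. i x choose j x)"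
proof -
  have "fact (i x) = fact (j x) * fact (i x - j x) * real (i x choose j x)" for x
    using binomial_fact_lemma[OF assms[of x]]
    by (metis of_nat_fact of_nat_mult)
  then show ?thesis by (simp add: mfact_def prod.distrib)
qed

lemma mfact_neq_0: "mfact j \<noteq> 0"
  by (simp add: mfact_def)

text \<open>Passing from k to k-2j shifts the parameter \<open>a\<close> by 2|j|, so the
  denominators merge: (a)_(2J) (a+2J)_(I-J) = (a)_(I+J). This explains the length 2|j| in
  \<open>c_coeff\<close> and |i|+m in \<open>B_coeff\<close>. Besides |j|, only the product of
  binomials still depends on j.\<close>

lemma c_coeff_b_coeff:
  fixes k i j :: "'d::finite \<Rightarrow> nat" and \<mu> :: real
  assumes L: "lam CARD('d) \<mu> > 0" and i: "i \<in> half_le k" and ji: "\<And>x. j x \<le> i x"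
  defines "a \<equiv> - real (mabs k) - lam CARD('d) \<mu> + 1"
  shows "c_coeff \<mu> k j * b_coeff \<mu> (\<lambda>x. k x - 2 * j x) (\<lambda>x. i x - j x)
    = (-1) ^ mabs j * mpoch (\<lambda>x. - real (k x) / 2) i * mpoch (\<lambda>x. (- real (k x) + 1) / 2) i
      / (pochhammer a (mabs i + mabs j) * mfact i)
      * real (\<Prod>x\<in>UNIV. i x choose j x) * (2 * pochhammer a (mabs j) - pochhammer (a - 1) (mabs j))"
proof -
  define I J where "I = mabs i" and "J = mabs j"
  define Z where "Z = 2 * pochhammer a J - pochhammer (a - 1) J"
  have jk: "2 * j x \<le> k x" for x
    using ji[of x] i by (auto simp: half_le_def dest!: spec[of _ x])
  have j: "j \<in> half_le k" using jk by (simp add: half_le_def)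
  have JI: "J \<le> I" unfolding I_def J_def using ji by (rule mabs_mono)
  have IK: "2 * I \<le> mabs k" using half_le_mabs[OF i] by (simp add: I_def)
  have s1: "mpoch (\<lambda>x. - real (k x - 2 * j x) / 2) (\<lambda>x. i x - j x)
      = mpoch (\<lambda>x. - real (k x) / 2 + real (j x)) (\<lambda>x. i x - j x)"
    using jk by (simp add: of_nat_diff diff_divide_distrib)
  have s2: "mpoch (\<lambda>x. (- real (k x - 2 * j x) + 1) / 2) (\<lambda>x. i x - j x)
      = mpoch (\<lambda>x. (- real (k x) + 1) / 2 + real (j x)) (\<lambda>x. i x - j x)"
  proof -
    have "(- real (k x - 2 * j x) + 1) / 2 = (- real (k x) + 1) / 2 + real (j x)" for x
      using jk[of x] by (simp add: of_nat_diff field_simps)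
    then show ?thesis by (simp only:)
  qed
  have s3: "- real (mabs (\<lambda>x. k x - 2 * j x)) - lam CARD('d) \<mu> + 1 = a + real (2 * J)"
    using half_le_mabs[OF j] by (simp add: mabs_minus_double[OF j] a_def J_def of_nat_diff)
  have s4: "pochhammer a (I + J) = pochhammer a (2 * J) * pochhammer (a + real (2 * J)) (I - J)"
    using pochhammer_product'[of a "2 * J" "I - J"] JI by (simp add: add.commute)
  have s5: "mabs (\<lambda>x. i x - j x) = I - J" using ji by (simp add: mabs_diff I_def J_def)
  have nz: "pochhammer a (I + J) \<noteq> 0"
    unfolding a_def using L JI IK by (intro pochhammer_neg_neq_0) auto
  then have nz': "pochhammer a (2 * J) \<noteq> 0" "pochhammer (a + real (2 * J)) (I - J) \<noteq> 0"
    unfolding s4 by auto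
  have c: "c_coeff \<mu> k j = (-1) ^ J * mpoch (\<lambda>x. - real (k x) / 2) j * mpoch (\<lambda>x. (- real (k x) + 1) / 2) j
      / (pochhammer a (2 * J) * mfact j) * Z"
    by (simp add: c_coeff_def Z_def a_def J_def)
  have b: "b_coeff \<mu> (\<lambda>x. k x - 2 * j x) (\<lambda>x. i x - j x)
     = mpoch (\<lambda>x. - real (k x) / 2 + real (j x)) (\<lambda>x. i x - j x)
       * mpoch (\<lambda>x. (- real (k x) + 1) / 2 + real (j x)) (\<lambda>x. i x - j x)
       / (pochhammer (a + real (2 * J)) (I - J) * mfact (\<lambda>x. i x - j x))"
    unfolding b_coeff_def s1 s2 s3 s5 by simp
  have m: "mfact i = mfact j * mfact (\<lambda>x. i x - j x) * real (\<Prod>x\<in>UNIV. i x choose j x)"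
    using ji by (rule mfact_split)
  then have bin: "real (\<Prod>x\<in>UNIV. i x choose j x) \<noteq> 0"
    using mfact_neq_0[of i] by auto
  have "c_coeff \<mu> k j * b_coeff \<mu> (\<lambda>x. k x - 2 * j x) (\<lambda>x. i x - j x)
    = (-1) ^ J * mpoch (\<lambda>x. - real (k x) / 2) i * mpoch (\<lambda>x. (- real (k x) + 1) / 2) i
      / (pochhammer a (I + J) * (mfact j * mfact (\<lambda>x. i x - j x))) * Z"
    unfolding c b s4 mpoch_split[OF ji, symmetric] by (simp add: mult_ac)
  also have "mfact j * mfact (\<lambda>x. i x - j x) = mfact i / real (\<Prod>x\<in>UNIV. i x choose j x)"
    unfolding m using bin by simp
  finally show ?thesis unfolding I_def J_def Z_def by (simp add: mult_ac)
qed

lemma sum_c_coeff_b_coeff: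
  fixes k i :: "'d::finite \<Rightarrow> nat" and \<mu> :: real
  assumes L: "lam CARD('d) \<mu> > 0" and i: "i \<in> half_le k"
  shows "(\<Sum>j | (\<forall>x. j x \<le> i x) \<and> mabs j = m.
      c_coeff \<mu> k j * b_coeff \<mu> (\<lambda>x. k x - 2 * j x) (\<lambda>x. i x - j x)) = B_coeff \<mu> k i m"
proof -
  define a where "a = - real (mabs k) - lam CARD('d) \<mu> + 1"
  define A where "A = (-1) ^ m * mpoch (\<lambda>x. - real (k x) / 2) i * mpoch (\<lambda>x. (- real (k x) + 1) / 2) i
      / (pochhammer a (mabs i + m) * mfact i)"
  define Z where "Z = 2 * pochhammer a m - pochhammer (a - 1) m"
  have "(\<Sum>j | (\<forall>x. j x \<le> i x) \<and> mabs j = m.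
      c_coeff \<mu> k j * b_coeff \<mu> (\<lambda>x. k x - 2 * j x) (\<lambda>x. i x - j x))
    = (\<Sum>j | (\<forall>x. j x \<le> i x) \<and> mabs j = m. A * real (\<Prod>x\<in>UNIV. i x choose j x) * Z)"
    by (intro sum.cong refl) (auto simp: c_coeff_b_coeff[OF L i] A_def Z_def a_def)
  also have "\<dots> = A * real (\<Sum>j | (\<forall>x. j x \<le> i x) \<and> mabs j = m. \<Prod>x\<in>UNIV. i x choose j x) * Z"
    by (simp only: of_nat_sum sum_distrib_left sum_distrib_right)
  also have "\<dots> = B_coeff \<mu> k i m"
    unfolding multi_index_Vandermonde_le by (simp add: B_coeff_def A_def Z_def a_def)
  finally show ?thesis .
qed

text \<open>A telescoping sum: every partial sum has a closed form, which is the statement suited to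
  induction. At M = I+1 the factor (I choose M) is zero. The factors c+m+r occurring have m and r up
  to I+1, hence the range in \<open>nz\<close>.\<close>

lemma alternating_pochhammer_sum:
  fixes c :: real
  assumes nz: "\<And>r. r \<le> 2 * Suc I \<Longrightarrow> c + real r \<noteq> 0"
    and "M \<le> Suc I"
  shows "(\<Sum>m\<le>M. (-1) ^ m * real (Suc I choose m) * (c + 2 * real m) / pochhammer (c + real m) (I + 2))
     = (-1) ^ M * real (I choose M) / pochhammer (c + real M + 1) (Suc I)"
  using assms(2)
proof (induction M)
  case 0
  have "pochhammer c (I + 2) = c * pochhammer (c + 1) (Suc I)"
    by (simp add: pochhammer_rec)
  then show ?case using nz[of 0] by simp
next
  case (Suc M)
  define y where "y = c + real (Suc M)"
  define P where "P = pochhammer (y + 1) I"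
  have y0: "y \<noteq> 0" using nz[of "Suc M"] Suc.prems by (simp add: y_def)
  have y1: "y + real (Suc I) \<noteq> 0" using nz[of "Suc M + Suc I"] Suc.prems by (simp add: y_def add_ac)
  have P0: "P \<noteq> 0"
    unfolding P_def pochhammer_eq_0_iff
  proof (safe)
    fix r assume r: "r < I" "y + 1 = - real r"
    then show False using nz[of "Suc M + 1 + r"] Suc.prems by (simp add: y_def algebra_simps)
  qed
  have p1: "pochhammer y (I + 2) = y * P * (y + real (Suc I))"
    using pochhammer_rec[of y "Suc I"] pochhammer_Suc[of "y + 1" I] by (simp add: P_def algebra_simps)
  have p2: "pochhammer (c + real M + 1) (Suc I) = y * P"
    by (simp add: pochhammer_rec P_def y_def add_ac)
  have p3: "pochhammer (c + real (Suc M) + 1) (Suc I) = P * (y + real (Suc I))"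
    by (simp add: pochhammer_Suc P_def y_def add_ac)
  have bin: "real (Suc I choose Suc M) = real (I choose M) + real (I choose Suc M)" by simp
  \<comment> \<open>By this absorption identity everything except -(I choose M+1) y cancels in the
    combined numerator below.\<close>
  have bin2: "real (Suc M) * (real (I choose M) + real (I choose Suc M)) = real (Suc I) * real (I choose M)"
    unfolding bin[symmetric] of_nat_mult[symmetric] by (simp only: Suc_times_binomial)
  have "c + 2 * real (Suc M) = y + real (Suc M)" by (simp add: y_def)
  then have last: "(-1) ^ Suc M * real (Suc I choose Suc M) * (c + 2 * real (Suc M)) / pochhammer (c + real (Suc M)) (I + 2)
     = - ((-1) ^ M * (real (I choose M) + real (I choose Suc M)) * (y + real (Suc M)) / (y * P * (y + real (Suc I))))"
    unfolding bin y_def[symmetric] p1 by simp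
  have "(\<Sum>m\<le>Suc M. (-1) ^ m * real (Suc I choose m) * (c + 2 * real m) / pochhammer (c + real m) (I + 2))
     = (-1) ^ M * real (I choose M) / (y * P)
       - (-1) ^ M * (real (I choose M) + real (I choose Suc M)) * (y + real (Suc M)) / (y * P * (y + real (Suc I)))"
    unfolding sum.atMost_Suc Suc.IH[OF Suc_leD[OF Suc.prems]] p2 last by simp
  also have "\<dots> = (-1) ^ M * (real (I choose M) * (y + real (Suc I))
        - (real (I choose M) + real (I choose Suc M)) * (y + real (Suc M))) / (y * P * (y + real (Suc I)))"
    using y0 y1 P0 by (simp add: divide_simps) (simp add: algebra_simps)
  also have "real (I choose M) * (y + real (Suc I))
        - (real (I choose M) + real (I choose Suc M)) * (y + real (Suc M)) = - real (I choose Suc M) * y"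
    using bin2 by (simp add: algebra_simps del: of_nat_Suc)
  also have "(-1) ^ M * (- real (I choose Suc M) * y) / (y * P * (y + real (Suc I)))
     = (-1) ^ Suc M * real (I choose Suc M) / (P * (y + real (Suc I)))"
    using y0 by simp
  finally show ?case unfolding p3 .
qed

text \<open>Because (c)_m (c+m) = c (c+1)_m, the summands for |i| > 0 take the form treated in
  \<open>alternating_pochhammer_sum\<close>. Terms beyond m = |i| vanish, so a single bound M serves
  all i at once.\<close>

lemma sum_B_coeff:
  fixes k i :: "'d::finite \<Rightarrow> nat" and \<mu> :: real
  assumes L: "lam CARD('d) \<mu> > 0" and i: "i \<in> half_le k" and M: "mabs i \<le> M"
  shows "(\<Sum>m\<le>M. B_coeff \<mu> k i m) = (if mabs i = 0 then 1 else 0)"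
proof -
  have "(\<Sum>m\<le>M. B_coeff \<mu> k i m) = (\<Sum>m\<le>mabs i. B_coeff \<mu> k i m)"
    using M by (intro sum.mono_neutral_right) (auto simp: B_coeff_def binomial_eq_0)
  also have "\<dots> = (if mabs i = 0 then 1 else 0)"
  proof (cases "mabs i")
    case 0
    then have "i x = 0" for x using member_le_sum[of x UNIV i] by (simp add: mabs_def)
    then show ?thesis by (simp add: B_coeff_def mpoch_def mfact_def mabs_def)
  next
    case (Suc I)
    define c where "c = - real (mabs k) - lam CARD('d) \<mu>"
    have IK: "2 * Suc I \<le> mabs k" using half_le_mabs[OF i] Suc by simp
    have nz: "c + real r \<noteq> 0" if "r \<le> 2 * Suc I" for r
      using that IK L by (simp add: c_def)
    define A where "A = mpoch (\<lambda>x. - real (k x) / 2) i * mpoch (\<lambda>x. (- real (k x) + 1) / 2) i / mfact i"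
    have "B_coeff \<mu> k i m = A * ((-1) ^ m * real (Suc I choose m) * (c + 2 * real m)
        / pochhammer (c + real m) (I + 2))" if m: "m \<le> Suc I" for m
    proof -
      have 1: "pochhammer (c + 1) (Suc I + m) = pochhammer (c + 1) m * pochhammer (c + 1 + real m) (Suc I)"
        using pochhammer_product'[of "c + 1" m "Suc I"] by (simp add: add.commute)
      have 2: "pochhammer (c + real m) (I + 2) = (c + real m) * pochhammer (c + 1 + real m) (Suc I)"
        by (simp add: pochhammer_rec[of "c + real m"] add_ac)
      have 3: "pochhammer c m * (c + real m) = c * pochhammer (c + 1) m"
        using pochhammer_Suc[of c m] pochhammer_rec[of c m] by simp
      have nzm: "c + real m \<noteq> 0" using nz[of m] m by simp
      have nzp: "pochhammer (c + 1) (Suc I + m) \<noteq> 0"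
        unfolding c_def using L IK m
          pochhammer_neg_neq_0[OF L, of "Suc I + m" "mabs k"] by simp
      then have nzp': "pochhammer (c + 1) m \<noteq> 0" "pochhammer (c + 1 + real m) (Suc I) \<noteq> 0"
        unfolding 1 by auto
      have "(2 * pochhammer (c + 1) m - pochhammer c m) * (c + real m)
          = pochhammer (c + 1) m * (c + 2 * real m)"
        using 3 by (simp add: algebra_simps)
      then have 4: "2 * pochhammer (c + 1) m - pochhammer c m
          = pochhammer (c + 1) m * (c + 2 * real m) / (c + real m)"
        using nzm by (simp add: field_simps)
      have "B_coeff \<mu> k i m = A * ((-1) ^ m * real (Suc I choose m)
         * ((2 * pochhammer (c + 1) m - pochhammer c m) / pochhammer (c + 1) (Suc I + m)))"
        unfolding B_coeff_def A_def c_def Suc by (simp add: mult_ac)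
      also have "(2 * pochhammer (c + 1) m - pochhammer c m) / pochhammer (c + 1) (Suc I + m)
         = (c + 2 * real m) / pochhammer (c + real m) (I + 2)"
        unfolding 4 1 2 using nzp' nzm by simp
      finally show ?thesis by simp
    qed
    then have "(\<Sum>m\<le>Suc I. B_coeff \<mu> k i m) = A * (\<Sum>m\<le>Suc I. (-1) ^ m * real (Suc I choose m)
        * (c + 2 * real m) / pochhammer (c + real m) (I + 2))"
      by (simp add: sum_distrib_left del: sum.atMost_Suc)
    also have "\<dots> = 0"
      using alternating_pochhammer_sum[of I c "Suc I"] nz by (simp add: binomial_eq_0 del: sum.atMost_Suc)
    finally show ?thesis using Suc by (simp del: sum.atMost_Suc)
  qed
  finally show ?thesis .
qed

text \<open>The grouping by |j| = m is forced by the cone: the radial factor of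
  \<open>S_cone\<close> at k-2j depends on j only through |j|.\<close>

definition monomial_component :: "real \<Rightarrow> ('d::finite \<Rightarrow> nat) \<Rightarrow> nat \<Rightarrow> real ^ 'd \<Rightarrow> real" where
  "monomial_component \<mu> k m x =
     (\<Sum>j\<in>{j \<in> half_le k. mabs j = m}. c_coeff \<mu> k j * V_ball \<mu> (\<lambda>i. k i - 2 * j i) x)"

lemma monomial_component_eq:
  fixes k :: "'d::finite \<Rightarrow> nat" and \<mu> :: real
  assumes L: "lam CARD('d) \<mu> > 0"
  shows "monomial_component \<mu> k m x
    = (\<Sum>i\<in>half_le k. B_coeff \<mu> k i m * mpow x (\<lambda>l. k l - 2 * i l))"
proof -
  let ?g = "\<lambda>j j'. c_coeff \<mu> k j * b_coeff \<mu> (\<lambda>x. k x - 2 * j x) j' * mpow x (\<lambda>l. k l - 2 * j l - 2 * j' l)"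
  let ?h = "\<lambda>i j. c_coeff \<mu> k j * b_coeff \<mu> (\<lambda>x. k x - 2 * j x) (\<lambda>x. i x - j x) * mpow x (\<lambda>l. k l - 2 * i l)"
  have "monomial_component \<mu> k m x
     = (\<Sum>(j, j')\<in>Sigma {j \<in> half_le k. mabs j = m} (\<lambda>j. half_le (\<lambda>i. k i - 2 * j i)). ?g j j')"
    by (simp add: monomial_component_def V_ball_def sum_distrib_left sum.Sigma finite_half_le mult.assoc)
  also have "\<dots> = (\<Sum>(i, j)\<in>Sigma (half_le k) (\<lambda>i. {j. (\<forall>x. j x \<le> i x) \<and> mabs j = m}). ?h i j)"
  \<comment> \<open>The terms are collected by the total shift i = j + j', so that all terms of one
    inner sum share the monomial x^(k-2i).\<close>
  proof (rule sum.reindex_bij_witness[where i = "\<lambda>(i, j). (j, \<lambda>x. i x - j x)"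
        and j = "\<lambda>(j, j'). (\<lambda>x. j x + j' x, j)"], goal_cases)
    case (2 p)
    have "2 * (a + b) \<le> c" if "2 * a \<le> c" "2 * b \<le> c - 2 * a" for a b c :: nat
      using that by arith
    with 2 show ?case by (auto simp: half_le_def)
  next
    case (4 p)
    have *: "2 * b \<le> c \<and> 2 * (a - b) \<le> c - 2 * b" if "2 * a \<le> c" "b \<le> a" for a b c :: nat
      using that by arith
    obtain i j where p: "p = (i, j)" by (cases p)
    have "2 * j x \<le> k x \<and> 2 * (i x - j x) \<le> k x - 2 * j x" for x
      using 4 p by (intro *) (auto simp: half_le_def)
    with 4 p show ?case by (auto simp: half_le_def)
  qed (auto simp: algebra_simps)
  also have "\<dots> = (\<Sum>i\<in>half_le k. \<Sum>j | (\<forall>x. j x \<le> i x) \<and> mabs j = m. ?h i j)"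
    by (intro sum.Sigma[symmetric] finite_half_le ballI finite_subset[OF _ finite_mabs_eq[of m]]) auto
  also have "\<dots> = (\<Sum>i\<in>half_le k. B_coeff \<mu> k i m * mpow x (\<lambda>l. k l - 2 * i l))"
    by (simp add: sum_c_coeff_b_coeff[OF L] sum_distrib_right[symmetric])
  finally show ?thesis .
qed

lemma sum_monomial_component:
  fixes k :: "'d::finite \<Rightarrow> nat" and \<mu> :: real
  assumes L: "lam CARD('d) \<mu> > 0"
  shows "(\<Sum>m\<le>mabs k div 2. monomial_component \<mu> k m x) = mpow x k"
proof -
  have "(\<Sum>m\<le>mabs k div 2. monomial_component \<mu> k m x)
     = (\<Sum>i\<in>half_le k. (\<Sum>m\<le>mabs k div 2. B_coeff \<mu> k i m) * mpow x (\<lambda>l. k l - 2 * i l))"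
    unfolding monomial_component_eq[OF L] by (subst sum.swap) (simp add: sum_distrib_right)
  also have "\<dots> = (\<Sum>i\<in>half_le k. if i = (\<lambda>_. 0) then mpow x (\<lambda>l. k l - 2 * i l) else 0)"
  proof (intro sum.cong refl)
    fix i assume i: "i \<in> half_le k"
    have "mabs i = 0 \<longleftrightarrow> i = (\<lambda>_. 0)" by (auto simp: mabs_def fun_eq_iff)
    moreover have "mabs i \<le> mabs k div 2" using half_le_mabs[OF i] by simp
    ultimately show "(\<Sum>m\<le>mabs k div 2. B_coeff \<mu> k i m) * mpow x (\<lambda>l. k l - 2 * i l)
        = (if i = (\<lambda>_. 0) then mpow x (\<lambda>l. k l - 2 * i l) else 0)"
      by (simp add: sum_B_coeff[OF L i])
  qed
  also have "\<dots> = mpow x k" by (simp add: finite_half_le) (simp add: half_le_def)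
  finally show ?thesis .
qed

section \<open>Monomial integrals over the ball\<close>

definition ball_weight :: "real \<Rightarrow> real ^ 'd::finite \<Rightarrow> real" where
  "ball_weight \<mu> x = indicator (cball 0 1) x * (1 - (norm x)\<^sup>2) powr (\<mu> - 1 / 2)"

definition ball_integral :: "real \<Rightarrow> (real ^ 'd::finite \<Rightarrow> real) \<Rightarrow> real" where
  "ball_integral \<mu> f = (LINT x|lborel. f x * ball_weight \<mu> x)"

lemma ball_weight_nonneg: "ball_weight \<mu> x \<ge> 0"
  by (simp add: ball_weight_def)

lemma borel_measurable_ball_weight [measurable]: "ball_weight \<mu> \<in> borel_measurable borel"
proof -
  have [measurable]: "cball (0 :: real ^ 'a) 1 \<in> sets borel" by simp
  show ?thesis unfolding ball_weight_def by measurable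
qed

lemma borel_measurable_mpow [measurable]: "(\<lambda>x. mpow x k) \<in> borel_measurable borel"
proof -
  have "continuous_on UNIV (\<lambda>x :: real ^ 'a. mpow x k)"
    unfolding mpow_def by (intro continuous_intros)
  then show ?thesis by (rule borel_measurable_continuous_onI)
qed

section \<open>Dilations of Lebesgue measure and homogeneity of the weight\<close>

lemma nn_integral_lborel_scale:
  fixes f :: "'a::euclidean_space \<Rightarrow> ennreal"
  assumes [measurable]: "f \<in> borel_measurable borel" and t: "t > 0"
  shows "(\<integral>\<^sup>+x. f x \<partial>lborel) = ennreal (t ^ DIM('a)) * (\<integral>\<^sup>+x. f (t *\<^sub>R x) \<partial>lborel)"
  by (subst lborel_affine[of t 0])
     (use t in \<open>simp_all add: nn_integral_density nn_integral_distr nn_integral_cmult ennreal_power\<close>)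

lemma has_bochner_integral_lborel_scale:
  fixes f :: "'a::euclidean_space \<Rightarrow> real"
  assumes [measurable]: "f \<in> borel_measurable borel" and t: "t > 0"
    and f: "has_bochner_integral lborel (\<lambda>x. f (t *\<^sub>R x)) I"
  shows "has_bochner_integral lborel f (t ^ DIM('a) * I)"
proof -
  have "has_bochner_integral lborel (\<lambda>x. t ^ DIM('a) *\<^sub>R f (0 + t *\<^sub>R x)) (t ^ DIM('a) *\<^sub>R I)"
    using f by (intro has_bochner_integral_scaleR_right) simp
  then have "has_bochner_integral (distr lborel borel (\<lambda>x. 0 + t *\<^sub>R x)) (\<lambda>x. t ^ DIM('a) *\<^sub>R f x) (t ^ DIM('a) *\<^sub>R I)"
    by (intro has_bochner_integral_distr) simp_all
  then have "has_bochner_integral (density (distr lborel borel (\<lambda>x. 0 + t *\<^sub>R x)) (\<lambda>_. ennreal (t ^ DIM('a)))) f (t ^ DIM('a) *\<^sub>R I)"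
    using t by (intro has_bochner_integral_density) simp_all
  then show ?thesis using lborel_affine[of t "0 :: 'a"] t by (simp add: ennreal_power)
qed

lemma norm_power2_vec: "(norm x)\<^sup>2 = (\<Sum>i\<in>UNIV. (x $ i)\<^sup>2)" for x :: "real ^ 'd::finite"
  by (simp add: norm_vec_def L2_set_def sum_nonneg)

lemma mpow_scaleR: "mpow (c *\<^sub>R x) k = c ^ mabs k * mpow x k"
  by (simp add: mpow_def mabs_def power_mult_distrib prod.distrib power_sum)

lemma mpow_double_nonneg: "mpow x (\<lambda>i. 2 * k i) \<ge> 0"
  unfolding mpow_def by (intro prod_nonneg) (simp add: power_mult)

text \<open>The substitution x = t y in a slice of radius t. It serves twice: with t = sqrt u in the
  Gaussian computation and with t the height of a cone section.\<close>

lemma cone_weight_scale: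
  fixes x :: "real ^ 'd::finite"
  assumes t: "t > 0"
  shows "indicator {..t} (norm (t *\<^sub>R x)) * (t\<^sup>2 - (norm (t *\<^sub>R x))\<^sup>2) powr (\<mu> - 1 / 2)
    = t powr (2 * \<mu> - 1) * ball_weight \<mu> x"
proof (cases "norm x \<le> 1")
  case True
  have "t\<^sup>2 - (norm (t *\<^sub>R x))\<^sup>2 = t\<^sup>2 * (1 - (norm x)\<^sup>2)"
    by (simp add: power_mult_distrib algebra_simps)
  moreover have "1 - (norm x)\<^sup>2 \<ge> 0" using True by (simp add: power_le_one)
  ultimately have "(t\<^sup>2 - (norm (t *\<^sub>R x))\<^sup>2) powr (\<mu> - 1 / 2)
      = (t powr 2) powr (\<mu> - 1 / 2) * (1 - (norm x)\<^sup>2) powr (\<mu> - 1 / 2)"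
    using t by (simp add: powr_mult)
  then show ?thesis
    unfolding powr_powr using True t by (simp add: ball_weight_def right_diff_distrib)
next
  case False
  then have "\<not> norm (t *\<^sub>R x) \<le> t" using t by simp
  then show ?thesis using False by (simp add: ball_weight_def)
qed

section \<open>Even moments of the ball by comparison with Gaussian moments\<close>

lemma nn_integral_gaussian_power:
  "(\<integral>\<^sup>+x. ennreal (x ^ (2 * k) * exp (- x\<^sup>2)) \<partial>lborel) = ennreal (sqrt pi * pochhammer (1 / 2) k)"
proof -
  have "has_bochner_integral lborel (\<lambda>x. exp (- x\<^sup>2) * x ^ (2 * k)) (2 *\<^sub>R (sqrt pi / 2 * (fact (2 * k) / (2 ^ (2 * k) * fact k))))"
    by (rule has_bochner_integral_even_function[OF gaussian_moment_even_pos]) (simp add: power_mult)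
  then have "has_bochner_integral lborel (\<lambda>x. x ^ (2 * k) * exp (- x\<^sup>2)) (sqrt pi * pochhammer (1 / 2) k)"
    using power_mult[of "2 :: real" 2 k] by (simp add: pochhammer_one_half mult.commute)
  then show ?thesis
    by (subst nn_integral_eq_integral)
       (auto simp: has_bochner_integral_iff power_mult)
qed

lemma nn_integral_gaussian_mpow:
  fixes k :: "'d::finite \<Rightarrow> nat"
  shows "(\<integral>\<^sup>+x. ennreal (mpow x (\<lambda>i. 2 * k i) * exp (- (norm x)\<^sup>2)) \<partial>lborel)
    = ennreal (sqrt pi ^ CARD('d) * mpoch (\<lambda>_. 1 / 2) k)"
proof -
  \<comment> \<open>Product integrals over \<open>lborel\<close> are indexed by basis vectors;
    \<open>ix\<close> recovers the coordinate from its axis vector.\<close>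
  define ix :: "real ^ 'd \<Rightarrow> 'd" where "ix b = (THE i. b = axis i 1)" for b
  have ix: "ix (axis i 1) = i" for i
    unfolding ix_def by (rule the_equality) (auto simp: axis_eq_axis)
  have B: "(Basis :: (real ^ 'd) set) = (\<lambda>i. axis i 1) ` UNIV"
    by (auto simp: Basis_vec_def)
  have inj: "inj_on (\<lambda>i. axis i (1::real) :: real ^ 'd) UNIV"
    by (rule inj_onI) (simp add: axis_eq_axis)
  define g where "g i y = ennreal (y ^ (2 * k i) * exp (- y\<^sup>2))" for i and y :: real
  have gi: "integral\<^sup>N lborel (g i) = ennreal (sqrt pi * pochhammer (1 / 2) (k i))" for i
    using nn_integral_gaussian_power[of "k i"] by (simp add: g_def[abs_def])
  have "ennreal (mpow x (\<lambda>i. 2 * k i) * exp (- (norm x)\<^sup>2)) = (\<Prod>b\<in>Basis. g (ix b) (x \<bullet> b))" for x :: "real ^ 'd"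
  proof -
    have "mpow x (\<lambda>i. 2 * k i) * exp (- (norm x)\<^sup>2) = (\<Prod>i\<in>UNIV. (x $ i) ^ (2 * k i) * exp (- (x $ i)\<^sup>2))"
      by (simp add: mpow_def norm_power2_vec prod.distrib exp_sum sum_negf[symmetric])
    also have "ennreal \<dots> = (\<Prod>i\<in>UNIV. g i (x $ i))"
      unfolding g_def by (subst prod_ennreal) (simp_all add: power_mult)
    also have "\<dots> = (\<Prod>b\<in>Basis. g (ix b) (x \<bullet> b))"
      unfolding B by (subst prod.reindex[OF inj]) (simp add: ix inner_axis)
    finally show ?thesis .
  qed
  then have "(\<integral>\<^sup>+x. ennreal (mpow x (\<lambda>i. 2 * k i) * exp (- (norm x)\<^sup>2)) \<partial>lborel)
     = (\<integral>\<^sup>+x. (\<Prod>b\<in>Basis. g (ix b) (x \<bullet> b)) \<partial>(lborel :: (real ^ 'd) measure))"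
    by simp
  also have "\<dots> = (\<Prod>b\<in>(Basis :: (real ^ 'd) set). \<integral>\<^sup>+y. g (ix b) y \<partial>lborel)"
    by (rule nn_integral_lborel_prod) (simp_all add: g_def)
  also have "\<dots> = (\<Prod>i\<in>(UNIV :: 'd set). ennreal (sqrt pi * pochhammer (1 / 2) (k i)))"
    unfolding B by (subst prod.reindex[OF inj]) (simp add: ix gi)
  also have "\<dots> = ennreal (sqrt pi ^ CARD('d) * mpoch (\<lambda>_. 1 / 2) k)"
    by (subst prod_ennreal) (simp_all add: pochhammer_nonneg mpoch_def prod.distrib)
  finally show ?thesis .
qed

lemma nn_integral_Gamma_tail:
  assumes "\<mu> > - 1 / 2"
  shows "(\<integral>\<^sup>+u. ennreal (indicator {r..} u * (u - r) powr (\<mu> - 1 / 2) * exp (- u)) \<partial>lborel)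
    = ennreal (exp (- r) * Gamma (\<mu> + 1 / 2))"
proof -
  have "(\<integral>\<^sup>+u. ennreal (indicator {r..} u * (u - r) powr (\<mu> - 1 / 2) * exp (- u)) \<partial>lborel)
    = (\<integral>\<^sup>+v. ennreal (indicator {r..} (r + 1 * v) * ((r + 1 * v) - r) powr (\<mu> - 1 / 2) * exp (- (r + 1 * v))) \<partial>lborel)"
    by (subst nn_integral_real_affine[where c = 1 and t = r]) simp_all
  also have "\<dots> = (\<integral>\<^sup>+v. ennreal (exp (- r)) * ennreal (indicator {0..} v * v powr (\<mu> + 1 / 2 - 1) / exp v) \<partial>lborel)"
  proof (intro nn_integral_cong)
    fix v :: real
    have e: "exp (- (r + 1 * v)) = exp (- r) / exp v" by (simp add: exp_diff[symmetric])
    show "ennreal (indicator {r..} (r + 1 * v) * ((r + 1 * v) - r) powr (\<mu> - 1 / 2) * exp (- (r + 1 * v)))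
      = ennreal (exp (- r)) * ennreal (indicator {0..} v * v powr (\<mu> + 1 / 2 - 1) / exp v)"
      unfolding e by (subst ennreal_mult[symmetric]) (auto split: split_indicator)
  qed
  also have "\<dots> = ennreal (exp (- r)) * ennreal (Gamma (\<mu> + 1 / 2))"
    using assms by (subst nn_integral_cmult) (simp_all add: Gamma_conv_nn_integral_real)
  finally show ?thesis by (simp add: ennreal_mult')
qed

text \<open>Integrating \<open>x\<^sup>2\<^sup>k (u - |x|\<^sup>2)\<^sup>\<mu>\<^sup>-\<^sup>1\<^sup>/\<^sup>2 e\<^sup>-\<^sup>u\<close> over \<open>|x|\<^sup>2 \<le> u\<close> in both orders: \<open>u\<close> first gives a product of
  Gaussian moments, \<open>x\<close> first gives, by homogeneity, the ball integral times a Gamma value.\<close>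

lemma nn_integral_ball_monomial:
  fixes k :: "'d::finite \<Rightarrow> nat"
  assumes \<mu>: "\<mu> > - 1 / 2"
  shows "(\<integral>\<^sup>+x. ennreal (mpow x (\<lambda>i. 2 * k i) * ball_weight \<mu> x) \<partial>lborel)
      * ennreal (Gamma (lam CARD('d) \<mu> + 1 + real (mabs k)))
    = ennreal (sqrt pi ^ CARD('d) * Gamma (\<mu> + 1 / 2) * mpoch (\<lambda>_. 1 / 2) k)"
proof -
  define M where "M = (\<integral>\<^sup>+x. ennreal (mpow x (\<lambda>i. 2 * k i) * ball_weight \<mu> x) \<partial>(lborel :: (real ^ 'd) measure))"
  define s where "s = lam CARD('d) \<mu> + 1 + real (mabs k)"
  define h where "h u x = ennreal (mpow x (\<lambda>i. 2 * k i) * (indicator {(norm x)\<^sup>2..} u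
     * (u - (norm x)\<^sup>2) powr (\<mu> - 1 / 2) * exp (- u)))" for u and x :: "real ^ 'd"
  \<comment> \<open>With a fixed half-line and a moving argument, joint measurability in u and x
    follows automatically.\<close>
  have ind: "(indicator {(norm x)\<^sup>2..} u :: real) = indicator {0..} (u - (norm x)\<^sup>2)" for u and x :: "real ^ 'd"
    by (simp split: split_indicator)
  have meas [measurable]: "(\<lambda>(u, x). h u x) \<in> borel_measurable (lborel \<Otimes>\<^sub>M lborel)"
    unfolding h_def ind by measurable
  have s0: "s > 0"
  proof -
    have "real CARD('d) \<ge> 1" by (simp add: Suc_le_eq)
    then show ?thesis using \<mu> by (simp add: s_def lam_def field_simps)
  qed
  have "(\<integral>\<^sup>+x. (\<integral>\<^sup>+u. h u x \<partial>lborel) \<partial>lborel)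
     = (\<integral>\<^sup>+x. ennreal (Gamma (\<mu> + 1 / 2)) * ennreal (mpow x (\<lambda>i. 2 * k i) * exp (- (norm x)\<^sup>2)) \<partial>lborel)"
  proof (intro nn_integral_cong)
    fix x :: "real ^ 'd"
    have p: "mpow x (\<lambda>i. 2 * k i) \<ge> 0" by (rule mpow_double_nonneg)
    have "(\<integral>\<^sup>+u. h u x \<partial>lborel) = ennreal (mpow x (\<lambda>i. 2 * k i)) * ennreal (exp (- (norm x)\<^sup>2) * Gamma (\<mu> + 1 / 2))"
      unfolding h_def nn_integral_Gamma_tail[OF \<mu>, symmetric]
      by (subst nn_integral_cmult[symmetric]) (auto simp: ennreal_mult mpow_double_nonneg)
    also have "\<dots> = ennreal (Gamma (\<mu> + 1 / 2) * (mpow x (\<lambda>i. 2 * k i) * exp (- (norm x)\<^sup>2)))"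
      using p by (subst ennreal_mult'[symmetric]) (simp_all only: mult_ac)
    also have "\<dots> = ennreal (Gamma (\<mu> + 1 / 2)) * ennreal (mpow x (\<lambda>i. 2 * k i) * exp (- (norm x)\<^sup>2))"
      using \<mu> by (intro ennreal_mult') (simp add: Gamma_real_pos less_imp_le)
    finally show "(\<integral>\<^sup>+u. h u x \<partial>lborel) = ennreal (Gamma (\<mu> + 1 / 2)) * ennreal (mpow x (\<lambda>i. 2 * k i) * exp (- (norm x)\<^sup>2))" .
  qed
  also have "\<dots> = ennreal (Gamma (\<mu> + 1 / 2)) * ennreal (sqrt pi ^ CARD('d) * mpoch (\<lambda>_. 1 / 2) k)"
    by (subst nn_integral_cmult) (simp_all add: nn_integral_gaussian_mpow)
  also have "\<dots> = ennreal (sqrt pi ^ CARD('d) * Gamma (\<mu> + 1 / 2) * mpoch (\<lambda>_. 1 / 2) k)"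
    using \<mu> by (simp add: ennreal_mult'[symmetric] Gamma_real_pos less_imp_le mult_ac)
  finally have A: "(\<integral>\<^sup>+x. (\<integral>\<^sup>+u. h u x \<partial>lborel) \<partial>lborel)
      = ennreal (sqrt pi ^ CARD('d) * Gamma (\<mu> + 1 / 2) * mpoch (\<lambda>_. 1 / 2) k)" .
  have inner: "(\<integral>\<^sup>+x. h u x \<partial>lborel) = M * ennreal (indicator {0..} u * u powr (s - 1) / exp u)"
    if "u \<noteq> 0" for u
  proof (cases "u > 0")
    case True
    define t where "t = sqrt u"
    have t: "t > 0" "t\<^sup>2 = u" using True by (simp_all add: t_def)
    have "h u (t *\<^sub>R x) = ennreal (t ^ (2 * mabs k) * t powr (2 * \<mu> - 1) * exp (- u))
        * ennreal (mpow x (\<lambda>i. 2 * k i) * ball_weight \<mu> x)" for x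
    proof -
      have "(norm (t *\<^sub>R x))\<^sup>2 \<le> u \<longleftrightarrow> norm (t *\<^sub>R x) \<le> t"
        using t abs_le_square_iff[of "norm (t *\<^sub>R x)" t] by (simp del: norm_scaleR)
      then have "h u (t *\<^sub>R x) = ennreal (mpow (t *\<^sub>R x) (\<lambda>i. 2 * k i) *
          (indicator {..t} (norm (t *\<^sub>R x)) * (t\<^sup>2 - (norm (t *\<^sub>R x))\<^sup>2) powr (\<mu> - 1 / 2)) * exp (- u))"
        unfolding h_def t(2) by (simp add: indicator_def mult.assoc del: norm_scaleR)
      also have "\<dots> = ennreal ((t ^ (2 * mabs k) * t powr (2 * \<mu> - 1) * exp (- u)) * (mpow x (\<lambda>i. 2 * k i) * ball_weight \<mu> x))"
        unfolding cone_weight_scale[OF t(1)] mpow_scaleR mabs_double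
        by (simp only: mult_ac)
      finally show ?thesis using t by (simp add: ennreal_mult' mpow_double_nonneg ball_weight_nonneg)
    qed
    then have "(\<integral>\<^sup>+x. h u x \<partial>lborel) = ennreal (t ^ CARD('d)) * (ennreal (t ^ (2 * mabs k) * t powr (2 * \<mu> - 1) * exp (- u)) * M)"
      unfolding M_def by (subst nn_integral_lborel_scale[OF _ t(1)]) (simp_all add: nn_integral_cmult)
    also have "\<dots> = M * ennreal (t ^ CARD('d) * (t ^ (2 * mabs k) * t powr (2 * \<mu> - 1) * exp (- u)))"
      using t by (simp add: ennreal_mult' mult_ac)
    also have "t ^ CARD('d) * (t ^ (2 * mabs k) * t powr (2 * \<mu> - 1) * exp (- u))
       = indicator {0..} u * u powr (s - 1) / exp u"
    proof -
      \<comment> \<open>With u = t^2 the exponent 2(s-1) is the sum of d from the Jacobian, 2|k|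
        from the monomial and 2\<mu>-1 from the weight. This determines the choice of
        \<open>s\<close>.\<close>
      have "u powr (s - 1) = t powr (real CARD('d) + real (2 * mabs k) + (2 * \<mu> - 1))"
      proof -
        have "u powr (s - 1) = (t powr 2) powr (s - 1)" using t by simp
        also have "\<dots> = t powr (real CARD('d) + real (2 * mabs k) + (2 * \<mu> - 1))"
        proof -
          have "2 * (s - 1) = real CARD('d) + real (2 * mabs k) + (2 * \<mu> - 1)"
            by (simp add: s_def lam_def field_simps)
          then show ?thesis unfolding powr_powr by (rule arg_cong)
        qed
        finally show ?thesis .
      qed
      also have "\<dots> = t ^ CARD('d) * t ^ (2 * mabs k) * t powr (2 * \<mu> - 1)"
        by (simp only: powr_add powr_realpow[OF t(1)])
      finally show ?thesis using True by (simp add: exp_minus divide_inverse mult.assoc)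
    qed
    finally show ?thesis .
  next
    case False
    then have "u < 0" using that by simp
    then have "\<not> (norm x)\<^sup>2 \<le> u" for x :: "real ^ 'd"
      using zero_le_power2[of "norm x"] by linarith
    then have "h u x = 0" for x by (simp add: h_def)
    then show ?thesis using \<open>u < 0\<close> by simp
  qed
  have "(\<integral>\<^sup>+u. (\<integral>\<^sup>+x. h u x \<partial>lborel) \<partial>lborel) = (\<integral>\<^sup>+u. M * ennreal (indicator {0..} u * u powr (s - 1) / exp u) \<partial>lborel)"
    using AE_lborel_singleton[of "0::real"] by (intro nn_integral_cong_AE) (auto simp: inner)
  also have "\<dots> = M * ennreal (Gamma s)"
    by (subst nn_integral_cmult) (simp_all add: Gamma_conv_nn_integral_real[OF s0])
  finally have "(\<integral>\<^sup>+u. (\<integral>\<^sup>+x. h u x \<partial>lborel) \<partial>lborel) = M * ennreal (Gamma s)" .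
  moreover have "(\<integral>\<^sup>+u. (\<integral>\<^sup>+x. h u x \<partial>lborel) \<partial>lborel) = (\<integral>\<^sup>+x. (\<integral>\<^sup>+u. h u x \<partial>lborel) \<partial>lborel)"
    using lborel_pair.Fubini'[OF meas] by simp
  ultimately show ?thesis unfolding A M_def s_def by simp
qed

definition ball_mass :: "nat \<Rightarrow> real \<Rightarrow> real" where
  "ball_mass d \<mu> = sqrt pi ^ d * Gamma (\<mu> + 1 / 2) / Gamma (lam d \<mu> + 1)"

lemma lam_add_1_pos: "\<mu> > - 1 / 2 \<Longrightarrow> d \<ge> 1 \<Longrightarrow> lam d \<mu> + 1 > 0"
  by (simp add: lam_def field_simps)

lemma ball_mass_pos: "\<mu> > - 1 / 2 \<Longrightarrow> d \<ge> 1 \<Longrightarrow> ball_mass d \<mu> > 0"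
  unfolding ball_mass_def using lam_add_1_pos[of \<mu> d]
  by (intro divide_pos_pos mult_pos_pos Gamma_real_pos zero_less_power) auto

lemma mpoch_half_nonneg: "mpoch (\<lambda>_. 1 / 2) k \<ge> 0"
  unfolding mpoch_def by (intro prod_nonneg) (simp add: pochhammer_nonneg)

lemma has_bochner_integral_ball_even:
  fixes k :: "'d::finite \<Rightarrow> nat"
  assumes \<mu>: "\<mu> > - 1 / 2"
  shows "has_bochner_integral lborel (\<lambda>x. mpow x (\<lambda>i. 2 * k i) * ball_weight \<mu> x)
    (ball_mass CARD('d) \<mu> * (mpoch (\<lambda>_. 1 / 2) k / pochhammer (lam CARD('d) \<mu> + 1) (mabs k)))"
proof (rule has_bochner_integral_nn_integral)
  define L where "L = lam CARD('d) \<mu> + 1"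
  define C where "C = sqrt pi ^ CARD('d) * Gamma (\<mu> + 1 / 2) * mpoch (\<lambda>_. 1 / 2) k"
  have L: "L > 0" unfolding L_def using \<mu> by (intro lam_add_1_pos) (simp_all add: Suc_le_eq)
  then have GL: "Gamma L > 0" "Gamma (L + real (mabs k)) > 0" by (simp_all add: Gamma_real_pos)
  have G: "Gamma (L + real (mabs k)) = pochhammer L (mabs k) * Gamma L"
  proof -
    have "L \<notin> \<int>\<^sub>\<le>\<^sub>0" using L by (auto elim!: nonpos_Ints_cases)
    then have "pochhammer L (mabs k) = Gamma (L + real (mabs k)) / Gamma L"
      by (rule pochhammer_Gamma)
    then show ?thesis using GL(1) by simp
  qed
  have C0: "C \<ge> 0"
    unfolding C_def using \<mu> by (intro mult_nonneg_nonneg mpoch_half_nonneg) (simp_all add: Gamma_real_pos less_imp_le)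
  have val: "ball_mass CARD('d) \<mu> * (mpoch (\<lambda>_. 1 / 2) k / pochhammer (lam CARD('d) \<mu> + 1) (mabs k))
      = C / Gamma (L + real (mabs k))"
    unfolding G by (simp add: C_def ball_mass_def L_def)
  show "ball_mass CARD('d) \<mu> * (mpoch (\<lambda>_. 1 / 2) k / pochhammer (lam CARD('d) \<mu> + 1) (mabs k)) \<ge> 0"
    unfolding val using C0 GL by simp
  have "(\<integral>\<^sup>+x. ennreal (mpow x (\<lambda>i. 2 * k i) * ball_weight \<mu> x) \<partial>(lborel :: (real ^ 'd) measure)) * ennreal (Gamma (L + real (mabs k)))
     = ennreal (C / Gamma (L + real (mabs k))) * ennreal (Gamma (L + real (mabs k)))"
    using nn_integral_ball_monomial[OF \<mu>, of k] C0 GL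
    by (simp add: L_def[symmetric] C_def[symmetric] ennreal_mult[symmetric])
  \<comment> \<open>The Gamma value is finite and nonzero, so it can be cancelled in
    \<open>ennreal\<close>; the finiteness of the integral is a result of this and not an
    assumption.\<close>
  then show "(\<integral>\<^sup>+x. ennreal (mpow x (\<lambda>i. 2 * k i) * ball_weight \<mu> x) \<partial>(lborel :: (real ^ 'd) measure))
    = ennreal (ball_mass CARD('d) \<mu> * (mpoch (\<lambda>_. 1 / 2) k / pochhammer (lam CARD('d) \<mu> + 1) (mabs k)))"
    unfolding val mult.commute[of _ "ennreal (Gamma (L + real (mabs k)))"] ennreal_mult_cancel_left
    using GL by auto
qed (simp_all add: mpow_double_nonneg ball_weight_nonneg)

lemma has_bochner_integral_ball_weight:
  assumes "\<mu> > - 1 / 2"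
  shows "has_bochner_integral lborel (ball_weight \<mu> :: real ^ 'd::finite \<Rightarrow> real) (ball_mass CARD('d) \<mu>)"
  using has_bochner_integral_ball_even[OF assms, of "\<lambda>_ :: 'd. 0"]
  by (simp add: mpow_def mpoch_def mabs_def)

lemma abs_mpow_le_1:
  assumes "norm x \<le> 1"
  shows "\<bar>mpow x a\<bar> \<le> 1"
proof -
  have "\<bar>x $ i\<bar> \<le> 1" for i using component_le_norm_cart[of x i] assms by linarith
  then show ?thesis
    unfolding mpow_def abs_prod power_abs by (intro prod_le_1) (simp add: power_le_one)
qed

lemma integrable_ball_mpow:
  assumes "\<mu> > - 1 / 2"
  shows "integrable lborel (\<lambda>x :: real ^ 'd::finite. mpow x a * ball_weight \<mu> x)"
proof (rule Bochner_Integration.integrable_bound)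
  show "integrable lborel (ball_weight \<mu> :: real ^ 'd \<Rightarrow> real)"
    using has_bochner_integral_ball_weight[OF assms] by (rule integrable.intros)
  have "\<bar>mpow x a * ball_weight \<mu> x\<bar> \<le> \<bar>ball_weight \<mu> x\<bar>" for x :: "real ^ 'd"
  proof (cases "norm x \<le> 1")
    case True
    then show ?thesis using mult_right_mono[OF abs_mpow_le_1[OF True, of a], of "\<bar>ball_weight \<mu> x\<bar>"]
      by (simp add: abs_mult)
  qed (simp add: ball_weight_def)
  then show "AE x in lborel. norm (mpow x a * ball_weight \<mu> x) \<le> norm (ball_weight \<mu> x :: real)"
    by simp
qed simp

text \<open>The reflection \<open>T\<close> in coordinate i preserves Lebesgue measure and the
  weight but negates the monomial, so the integral equals its own negative.\<close>

lemma ball_integral_mpow_odd: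
  fixes a :: "'d::finite \<Rightarrow> nat"
  assumes i: "odd (a i)"
  shows "ball_integral \<mu> (\<lambda>x. mpow x a) = 0"
proof -
  define c :: "real ^ 'd \<Rightarrow> real" where "c b = (if b = axis i 1 then - 1 else 1)" for b
  define T where "T x = 0 + (\<Sum>b\<in>Basis. (c b * (x \<bullet> b)) *\<^sub>R b)" for x :: "real ^ 'd"
  have "T x \<bullet> axis l 1 = c (axis l 1) * (x \<bullet> axis l 1)" for x l
    unfolding T_def by (simp add: inner_sum_left_Basis axis_in_Basis_iff)
  then have T: "T x $ l = (if l = i then - (x $ l) else x $ l)" for x l
    by (simp add: inner_axis c_def axis_eq_axis)
  have [measurable]: "T \<in> borel_measurable borel"
    unfolding T_def[abs_def] by measurable
  have "lborel = density (distr lborel borel T) (\<lambda>_. (\<Prod>b\<in>Basis. \<bar>c b\<bar>))"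
    unfolding T_def[abs_def] by (rule lborel_affine_euclidean) (simp add: c_def)
  moreover have "(\<Prod>b\<in>Basis. \<bar>c b\<bar>) = 1" by (intro prod.neutral) (simp add: c_def)
  ultimately have "lborel = distr lborel borel T" by (simp add: density_1)
  then have "ball_integral \<mu> (\<lambda>x. mpow x a) = (LINT x|distr lborel borel T. mpow x a * ball_weight \<mu> x)"
    unfolding ball_integral_def by simp
  also have "\<dots> = (LINT x|lborel. mpow (T x) a * ball_weight \<mu> (T x))"
    by (rule integral_distr) simp_all
  also have "\<dots> = (LINT x|lborel. - (mpow x a * ball_weight \<mu> x))"
  proof (rule Bochner_Integration.integral_cong[OF refl])
    fix x
    have "mpow (T x) a = (\<Prod>l\<in>UNIV. (if l = i then - 1 else 1) * (x $ l) ^ a l)"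
      unfolding mpow_def T by (intro prod.cong) (use i in auto)
    then have "mpow (T x) a = - mpow x a" by (simp add: prod.distrib mpow_def)
    moreover have "norm (T x) = norm x"
      unfolding norm_vec_def T by (intro arg_cong2[where f = L2_set]) auto
    ultimately show "mpow (T x) a * ball_weight \<mu> (T x) = - (mpow x a * ball_weight \<mu> x)"
      by (simp add: ball_weight_def indicator_def)
  qed
  also have "\<dots> = - ball_integral \<mu> (\<lambda>x. mpow x a)" by (simp add: ball_integral_def)
  finally show ?thesis by simp
qed

lemma ball_integral_mpow:
  fixes a :: "'d::finite \<Rightarrow> nat"
  assumes "\<mu> > - 1 / 2"
  shows "ball_integral \<mu> (\<lambda>x. mpow x a) = ball_mass CARD('d) \<mu> * ball_moment (lam CARD('d) \<mu>) a"
proof (cases "\<forall>i. even (a i)")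
  case True
  define k where "k i = a i div 2" for i
  have a: "a = (\<lambda>i. 2 * k i)" using True by (auto simp: k_def)
  then have "mabs a = 2 * mabs k" using mabs_double[of k] by simp
  then show ?thesis
    using True has_bochner_integral_integral_eq[OF has_bochner_integral_ball_even[OF assms, of k]]
    by (simp add: ball_moment_def ball_integral_def a)
next
  case False
  then show ?thesis using ball_integral_mpow_odd by (auto simp: ball_moment_def)
qed

section \<open>Integration over the cone\<close>

lemma has_bochner_integral_cone_section:
  fixes F :: "real ^ 'd::finite \<Rightarrow> real"
  assumes t: "t > 0" and [measurable]: "F \<in> borel_measurable borel"
    and F: "has_bochner_integral lborel (\<lambda>x. F x * ball_weight \<mu> x) I"
  shows "has_bochner_integral lborel
    (\<lambda>x. F (x /\<^sub>R t) * (indicator {..t} (norm x) * (t\<^sup>2 - (norm x)\<^sup>2) powr (\<mu> - 1 / 2)))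
    (t powr (real CARD('d) + 2 * \<mu> - 1) * I)"
proof -
  have "has_bochner_integral lborel (\<lambda>x. t powr (2 * \<mu> - 1) * (F x * ball_weight \<mu> x)) (t powr (2 * \<mu> - 1) * I)"
    using F by (rule has_bochner_integral_mult_right)
  also have "(\<lambda>x. t powr (2 * \<mu> - 1) * (F x * ball_weight \<mu> x)) = (\<lambda>x. F ((t *\<^sub>R x) /\<^sub>R t) *
      (indicator {..t} (norm (t *\<^sub>R x)) * (t\<^sup>2 - (norm (t *\<^sub>R x))\<^sup>2) powr (\<mu> - 1 / 2)))"
    unfolding cone_weight_scale[OF t] using t by (simp add: mult_ac)
  finally have "has_bochner_integral lborel
    (\<lambda>x. F (x /\<^sub>R t) * (indicator {..t} (norm x) * (t\<^sup>2 - (norm x)\<^sup>2) powr (\<mu> - 1 / 2)))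
    (t ^ DIM(real ^ 'd) * (t powr (2 * \<mu> - 1) * I))"
    by (intro has_bochner_integral_lborel_scale t) measurable
  also have "t ^ DIM(real ^ 'd) * (t powr (2 * \<mu> - 1) * I) = t powr (real CARD('d) + (2 * \<mu> - 1)) * I"
    using t by (simp add: powr_add powr_realpow)
  finally show ?thesis by (simp add: add_diff_eq)
qed

lemma has_bochner_integral_cone_borel:
  fixes F :: "real ^ 'd::finite \<Rightarrow> real" and g :: "real \<Rightarrow> real" and \<mu> :: real
  defines "a \<equiv> real CARD('d) + 2 * \<mu> - 1"
  assumes [measurable]: "F \<in> borel_measurable borel" "g \<in> borel_measurable borel"
    and F: "integrable lborel (\<lambda>x. F x * ball_weight \<mu> x)"
    and g: "integrable lborel (\<lambda>t. indicator {0<..} t * (t powr a * g t))"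
  shows "has_bochner_integral lborel
    (\<lambda>(x, t). indicator {0<..} t * g t *
      (F (x /\<^sub>R t) * (indicator {..t} (norm x) * (t\<^sup>2 - (norm x)\<^sup>2) powr (\<mu> - 1 / 2))))
    ((LINT t|lborel. indicator {0<..} t * (t powr a * g t)) * ball_integral \<mu> F)"
proof -
  define h where "h = (\<lambda>(t, x). indicator {0<..} t * g t *
      (F (x /\<^sub>R t) * (indicator {..t} (norm x) * (t\<^sup>2 - (norm x)\<^sup>2) powr (\<mu> - 1 / 2))))"
  have ind: "(indicator {..t} (norm x) :: real) = indicator {0..} (t - norm x)" for t and x :: "real ^ 'd"
    by (simp split: split_indicator)
  have meas [measurable]: "h \<in> borel_measurable (lborel \<Otimes>\<^sub>M lborel)"
    unfolding h_def ind by measurable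
  \<comment> \<open>General in \<open>G\<close> and \<open>g\<close> because the slice formula is
    needed twice: for the value, and with absolute values for the integrability condition of
    Fubini's theorem.\<close>
  have sec: "has_bochner_integral lborel (\<lambda>x. indicator {0<..} t * g t *
      (G (x /\<^sub>R t) * (indicator {..t} (norm x) * (t\<^sup>2 - (norm x)\<^sup>2) powr (\<mu> - 1 / 2))))
      (indicator {0<..} t * (t powr a * g t) * I)"
    if [measurable]: "G \<in> borel_measurable borel" and G: "has_bochner_integral lborel (\<lambda>x. G x * ball_weight \<mu> x) I"
    for G :: "real ^ 'd \<Rightarrow> real" and g :: "real \<Rightarrow> real" and t I
  proof (cases "t > 0")
    case True
    then show ?thesis
      using has_bochner_integral_mult_right[OF has_bochner_integral_cone_section[OF True _ G], of "g t"]
      by (simp add: a_def mult_ac)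
  qed (simp add: has_bochner_integral_zero)
  have FI: "has_bochner_integral lborel (\<lambda>x. F x * ball_weight \<mu> x) (ball_integral \<mu> F)"
    using F unfolding ball_integral_def by (rule has_bochner_integral_integrable)
  have h1: "has_bochner_integral lborel (\<lambda>x. h (t, x)) (indicator {0<..} t * (t powr a * g t) * ball_integral \<mu> F)" for t
    unfolding h_def prod.case by (rule sec[OF _ FI]) simp
  have "integrable lborel (\<lambda>x. \<bar>F x\<bar> * ball_weight \<mu> x)"
    using integrable_abs[OF F] by (simp add: abs_mult ball_weight_nonneg)
  then have aFI: "has_bochner_integral lborel (\<lambda>x. \<bar>F x\<bar> * ball_weight \<mu> x) (ball_integral \<mu> (\<lambda>x. \<bar>F x\<bar>))"
    unfolding ball_integral_def by (rule has_bochner_integral_integrable)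
  have h2: "has_bochner_integral lborel (\<lambda>x. norm (h (t, x))) (indicator {0<..} t * (t powr a * \<bar>g t\<bar>) * ball_integral \<mu> (\<lambda>x. \<bar>F x\<bar>))" for t
    using sec[OF _ aFI, of t "\<lambda>t. \<bar>g t\<bar>"] by (simp add: h_def abs_mult)
  have int: "integrable (lborel \<Otimes>\<^sub>M lborel) h"
  proof (rule lborel_pair.Fubini_integrable[OF meas])
    have "integrable lborel (\<lambda>t. \<bar>indicator {0<..} t * (t powr a * g t)\<bar> * ball_integral \<mu> (\<lambda>x. \<bar>F x\<bar>))"
      using integrable_abs[OF g] by (rule integrable_mult_left)
    then show "integrable lborel (\<lambda>t. LINT x|lborel. norm (h (t, x)))"
      unfolding has_bochner_integral_integral_eq[OF h2] by (simp add: abs_mult)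
    show "AE t in lborel. integrable lborel (\<lambda>x. h (t, x))"
      using integrable.intros[OF h1] by simp
  qed
  have "integral\<^sup>L (lborel \<Otimes>\<^sub>M lborel) h = (LINT t|lborel. indicator {0<..} t * (t powr a * g t)) * ball_integral \<mu> F"
    unfolding lborel_pair.integral_fst'[OF int, symmetric] has_bochner_integral_integral_eq[OF h1] by simp
  then have "has_bochner_integral (lborel \<Otimes>\<^sub>M lborel) (\<lambda>(x, t). h (t, x))
      ((LINT t|lborel. indicator {0<..} t * (t powr a * g t)) * ball_integral \<mu> F)"
    using lborel_pair.integrable_product_swap[OF int] lborel_pair.integral_product_swap[OF meas]
    by (simp add: has_bochner_integral_iff)
  then show ?thesis unfolding lborel_prod by (simp add: h_def)
qed

text \<open>The cone integrand need not be Borel. Computing with a Borel version and returning to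
  the completion by almost everywhere equality gives both integrability and value.\<close>

lemma has_bochner_integral_lebesgue_AE:
  fixes f f' :: "'a::euclidean_space \<Rightarrow> real"
  assumes f': "has_bochner_integral lborel f' I" and ae: "AE x in lborel. f x = f' x"
  shows "has_bochner_integral lebesgue f I"
proof -
  have m': "f' \<in> borel_measurable lborel" using f' by (rule borel_measurable_has_bochner_integral)
  then have m: "f' \<in> borel_measurable lebesgue" by (rule measurable_completion)
  have ae': "AE x in lebesgue. f x = f' x" using ae by (rule AE_completion)
  have mf: "f \<in> borel_measurable lebesgue"
  proof (rule measurableI)
    fix A :: "real set" assume "A \<in> sets borel"
    then have "f' -` A \<inter> space lebesgue \<in> sets lebesgue" using m by (intro measurable_sets)
    then show "f -` A \<inter> space lebesgue \<in> sets lebesgue"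
      by (rule completion.in_sets_AE[rotated]) (use ae' in \<open>auto elim: eventually_mono\<close>)
  qed simp
  have "has_bochner_integral lebesgue f' I"
    using f' m' by (simp add: has_bochner_integral_iff integrable_completion integral_completion)
  then show ?thesis
    using has_bochner_integral_cong_AE[OF mf m ae'] by simp
qed

text \<open>A cylinder over a null set is null, since infinity times 0 is 0 in
  \<open>ennreal\<close>. This carries exceptional sets of heights t over to the cone.\<close>

lemma AE_lborel_snd:
  assumes "AE t in (lborel :: 'b::euclidean_space measure). P t"
  shows "AE p in (lborel :: ('a::euclidean_space \<times> 'b) measure). P (snd p)"
proof -
  obtain N where N: "{t. \<not> P t} \<subseteq> N" "N \<in> sets borel" "emeasure lborel N = 0"
    using assms by (auto elim!: AE_E)
  have "emeasure (lborel \<Otimes>\<^sub>M lborel) ((UNIV :: 'a set) \<times> N) = 0"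
    using N by (subst lborel.emeasure_pair_measure_Times) auto
  then have "UNIV \<times> N \<in> null_sets (lborel :: ('a \<times> 'b) measure)"
    using N unfolding lborel_prod by (auto intro!: null_setsI borel_Times)
  then show ?thesis by (rule AE_I') (use N in auto)
qed

lemma has_bochner_integral_cone:
  fixes F :: "real ^ 'd::finite \<Rightarrow> real" and g :: "real \<Rightarrow> real" and \<mu> :: real
  defines "a \<equiv> real CARD('d) + 2 * \<mu> - 1"
  assumes F [measurable]: "F \<in> borel_measurable borel"
    and Fint: "integrable lborel (\<lambda>x. F x * ball_weight \<mu> x)"
    and g: "set_integrable lebesgue {0..} (\<lambda>t. t powr a * g t)"
  shows "has_bochner_integral lebesgue
    (\<lambda>(x, t). indicator solid_cone (x, t) * (g t * F (x /\<^sub>R t) * (t\<^sup>2 - (norm x)\<^sup>2) powr (\<mu> - 1 / 2)))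
    ((LINT t:{0..}|lebesgue. t powr a * g t) * ball_integral \<mu> F)"
proof -
  define u where "u t = indicator {0..} t * (t powr a * g t)" for t :: real
  have u: "integrable lebesgue u"
    using g by (simp add: set_integrable_def u_def[abs_def])
  then obtain v where v [measurable]: "v \<in> borel_measurable lborel" and uv: "AE t in lborel. u t = v t"
    using completion_ex_borel_measurable_real[of u lborel] by (auto dest: borel_measurable_integrable)
  \<comment> \<open>Borel since \<open>v\<close> is, and almost everywhere equal to \<open>g\<close>
    on t > 0, where division by t^a is harmless.\<close>
  define g' where "g' t = v t / t powr a" for t
  have g'v: "AE t in lborel. indicator {0<..} t * (t powr a * g' t) = v t"
    using uv AE_lborel_singleton[of "0::real"]
  proof eventually_elim
    case (elim t)
    then show ?case by (cases "t > 0") (auto simp: g'_def u_def)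
  qed
  have vI: "has_bochner_integral lborel v (integral\<^sup>L lebesgue u)"
  proof -
    have vl: "v \<in> borel_measurable lebesgue" using v by (rule measurable_completion)
    have "integrable lebesgue v \<and> integral\<^sup>L lebesgue u = integral\<^sup>L lebesgue v"
      using integrable_cong_AE_imp[OF u vl] integral_cong_AE[OF borel_measurable_integrable[OF u] vl]
        AE_completion[OF uv] by (auto simp: eq_commute)
    then show ?thesis
      by (simp add: has_bochner_integral_iff integrable_completion integral_completion)
  qed
  have g'm [measurable]: "g' \<in> borel_measurable borel" unfolding g'_def[abs_def] by measurable
  have g'I: "has_bochner_integral lborel (\<lambda>t. indicator {0<..} t * (t powr a * g' t)) (integral\<^sup>L lebesgue u)"
    using has_bochner_integral_cong_AE[OF _ v g'v] vI by simp
  have "has_bochner_integral lborel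
    (\<lambda>(x, t). indicator {0<..} t * g' t *
      (F (x /\<^sub>R t) * (indicator {..t} (norm x) * (t\<^sup>2 - (norm x)\<^sup>2) powr (\<mu> - 1 / 2))))
    (integral\<^sup>L lebesgue u * ball_integral \<mu> F)"
    using has_bochner_integral_cone_borel[OF F g'm Fint] g'I
    by (simp add: a_def has_bochner_integral_iff)
  moreover have "AE p in (lborel :: ((real ^ 'd) \<times> real) measure).
    (\<lambda>(x, t). indicator solid_cone (x, t) * (g t * F (x /\<^sub>R t) * (t\<^sup>2 - (norm x)\<^sup>2) powr (\<mu> - 1 / 2))) p
    = (\<lambda>(x, t). indicator {0<..} t * g' t *
      (F (x /\<^sub>R t) * (indicator {..t} (norm x) * (t\<^sup>2 - (norm x)\<^sup>2) powr (\<mu> - 1 / 2)))) p"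
    using AE_lborel_snd[OF uv] AE_lborel_snd[OF AE_lborel_singleton[of "0::real"]]
  proof eventually_elim
    case (elim p)
    obtain x t where p: "p = (x, t)" by (cases p)
    show ?case
    proof (cases "t > 0")
      case True
      then have "v t = t powr a * g t" using elim p by (simp add: u_def)
      then have "g' t = g t" using True by (simp add: g'_def)
      then show ?thesis using True p by (auto simp: solid_cone_def indicator_def)
    next
      case False
      then show ?thesis using elim p by (auto simp: solid_cone_def indicator_def)
    qed
  qed
  ultimately have "has_bochner_integral lebesgue
    (\<lambda>(x, t). indicator solid_cone (x, t) * (g t * F (x /\<^sub>R t) * (t\<^sup>2 - (norm x)\<^sup>2) powr (\<mu> - 1 / 2)))
    (integral\<^sup>L lebesgue u * ball_integral \<mu> F)"
    by (rule has_bochner_integral_lebesgue_AE)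
  then show ?thesis by (simp add: set_lebesgue_integral_def u_def[abs_def])
qed

section \<open>The norm formula\<close>

lemma V_cone_eq:
  fixes k :: "'d::finite \<Rightarrow> nat"
  shows "V_cone w \<mu> k n (x, t) = (\<Sum>m\<le>mabs k div 2.
     poly (q_poly w (n - (mabs k - 2 * m)) (2 * real (mabs k - 2 * m) + 2 * \<mu> + real CARD('d) - 1)) t
     * t ^ (mabs k - 2 * m) * monomial_component \<mu> k m (x /\<^sub>R t))"
proof -
  let ?q = "\<lambda>m. poly (q_poly w (n - (mabs k - 2 * m)) (2 * real (mabs k - 2 * m) + 2 * \<mu> + real CARD('d) - 1)) t
     * t ^ (mabs k - 2 * m)"
  let ?h = "\<lambda>j. ?q (mabs j) * (c_coeff \<mu> k j * V_ball \<mu> (\<lambda>i. k i - 2 * j i) (x /\<^sub>R t))"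
  have "V_cone w \<mu> k n (x, t) = (\<Sum>j\<in>half_le k. ?h j)"
    unfolding V_cone_def S_cone_def
  proof (rule sum.cong[OF refl])
    fix j assume "j \<in> half_le k"
    note e = mabs_minus_double[OF this]
    show "c_coeff \<mu> k j * (case (x, t) of (x, t) \<Rightarrow>
        poly (q_poly w (n - mabs (\<lambda>i. k i - 2 * j i))
          (2 * real (mabs (\<lambda>i. k i - 2 * j i)) + 2 * \<mu> + real CARD('d) - 1)) t *
        t ^ mabs (\<lambda>i. k i - 2 * j i) * V_ball \<mu> (\<lambda>i. k i - 2 * j i) (x /\<^sub>R t)) = ?h j"
      unfolding prod.case e by (simp only: mult_ac)
  qed
  also have "\<dots> = (\<Sum>m\<le>mabs k div 2. \<Sum>j\<in>{j \<in> half_le k. mabs j = m}. ?h j)"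
    using half_le_mabs by (intro sum.group[symmetric] finite_half_le) fastforce+
  also have "\<dots> = (\<Sum>m\<le>mabs k div 2. ?q m * monomial_component \<mu> k m (x /\<^sub>R t))"
    unfolding monomial_component_def by (simp add: sum_distrib_left)
  finally show ?thesis .
qed

lemma has_bochner_integral_ball_mpow_sum:
  fixes a :: "'i \<Rightarrow> 'd::finite \<Rightarrow> nat"
  assumes "\<mu> > - 1 / 2"
  shows "has_bochner_integral lborel (\<lambda>x. (\<Sum>i\<in>A. c i * mpow x (a i)) * ball_weight \<mu> x)
    (ball_mass CARD('d) \<mu> * (\<Sum>i\<in>A. c i * ball_moment (lam CARD('d) \<mu>) (a i)))"
proof -
  have "has_bochner_integral lborel (\<lambda>x. mpow x (a i) * ball_weight \<mu> x)
      (ball_mass CARD('d) \<mu> * ball_moment (lam CARD('d) \<mu>) (a i))" for i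
    using integrable_ball_mpow[OF assms, of "a i"] ball_integral_mpow[OF assms, of "a i"]
    by (simp add: has_bochner_integral_iff ball_integral_def)
  then have "has_bochner_integral lborel (\<lambda>x. \<Sum>i\<in>A. c i * (mpow x (a i) * ball_weight \<mu> x))
      (\<Sum>i\<in>A. c i * (ball_mass CARD('d) \<mu> * ball_moment (lam CARD('d) \<mu>) (a i)))"
    by (intro has_bochner_integral_sum has_bochner_integral_mult_right)
  then show ?thesis
    by (simp add: sum_distrib_left sum_distrib_right mult_ac)
qed

section \<open>Orthogonality and norms of the components of a monomial\<close>

lemma mpow_add: "mpow x a * mpow x b = mpow x (\<lambda>i. a i + b i)"
  by (simp add: mpow_def power_add prod.distrib)

lemma V_ball_orthogonal_mpow:
  fixes k l :: "'d::finite \<Rightarrow> nat"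
  assumes \<mu>: "\<mu> > - 1 / 2" and L: "lam CARD('d) \<mu> > 0" and lk: "mabs l < mabs k"
  shows "has_bochner_integral lborel (\<lambda>x. V_ball \<mu> k x * mpow x l * ball_weight \<mu> x) 0"
proof -
  have "V_ball \<mu> k x * mpow x l = (\<Sum>j\<in>half_le k. b_coeff \<mu> k j * mpow x (\<lambda>i. k i - 2 * j i + l i))" for x
    by (simp add: V_ball_def sum_distrib_right mult.assoc mpow_add)
  then show ?thesis
    using has_bochner_integral_ball_mpow_sum[OF \<mu>, where A = "half_le k" and c = "b_coeff \<mu> k" and a = "\<lambda>j i. k i - 2 * j i + l i"]
    by (simp add: ball_moment_orthogonal[OF L lk])
qed

lemma monomial_component_orthogonal_mpow:
  fixes k l :: "'d::finite \<Rightarrow> nat"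
  assumes \<mu>: "\<mu> > - 1 / 2" and L: "lam CARD('d) \<mu> > 0" and lk: "mabs l < mabs k - 2 * m"
  shows "has_bochner_integral lborel (\<lambda>x. monomial_component \<mu> k m x * mpow x l * ball_weight \<mu> x) 0"
proof -
  have "has_bochner_integral lborel (\<lambda>x. \<Sum>j\<in>{j \<in> half_le k. mabs j = m}.
      c_coeff \<mu> k j * (V_ball \<mu> (\<lambda>i. k i - 2 * j i) x * mpow x l * ball_weight \<mu> x))
      (\<Sum>j\<in>{j \<in> half_le k. mabs j = m}. c_coeff \<mu> k j * 0)"
    using lk by (intro has_bochner_integral_sum has_bochner_integral_mult_right V_ball_orthogonal_mpow \<mu> L)
      (auto simp: mabs_minus_double)
  then show ?thesis
    by (simp add: monomial_component_def sum_distrib_right mult.assoc)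
qed

text \<open>Only the component of lower degree is expanded. Its monomials have |i| >= m', as (|i|
  choose m') vanishes otherwise, so their degree is at most |k| - 2m'. The bound on m' keeps this
  below |k| - 2m in truncated subtraction as well.\<close>

lemma monomial_component_orthogonal_less:
  fixes k :: "'d::finite \<Rightarrow> nat"
  assumes \<mu>: "\<mu> > - 1 / 2" and L: "lam CARD('d) \<mu> > 0" and m: "m < m'" "2 * m' \<le> mabs k"
  shows "has_bochner_integral lborel
    (\<lambda>x. monomial_component \<mu> k m x * monomial_component \<mu> k m' x * ball_weight \<mu> x) 0"
proof -
  have "has_bochner_integral lborel (\<lambda>x. \<Sum>i\<in>half_le k. B_coeff \<mu> k i m' *
      (monomial_component \<mu> k m x * mpow x (\<lambda>l. k l - 2 * i l) * ball_weight \<mu> x)) (\<Sum>i\<in>half_le k. 0)"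
  proof (rule has_bochner_integral_sum)
    fix i assume i: "i \<in> half_le k"
    show "has_bochner_integral lborel (\<lambda>x. B_coeff \<mu> k i m' *
      (monomial_component \<mu> k m x * mpow x (\<lambda>l. k l - 2 * i l) * ball_weight \<mu> x)) 0"
    proof (cases "mabs i < m'")
      case True
      then show ?thesis by (simp add: B_coeff_def binomial_eq_0 has_bochner_integral_zero)
    next
      case False
      then have "mabs (\<lambda>l. k l - 2 * i l) < mabs k - 2 * m"
        using m by (simp add: mabs_minus_double[OF i])
      then show ?thesis
        using has_bochner_integral_mult_right[OF monomial_component_orthogonal_mpow[OF \<mu> L], where c = "B_coeff \<mu> k i m'"]
        by fastforce
    qed
  qed
  then show ?thesis
    unfolding monomial_component_eq[OF L, of k m'] by (simp add: sum_distrib_left sum_distrib_right mult_ac)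
qed

lemma monomial_component_orthogonal:
  fixes k :: "'d::finite \<Rightarrow> nat"
  assumes "\<mu> > - 1 / 2" "lam CARD('d) \<mu> > 0" "m \<noteq> m'" "m \<le> mabs k div 2" "m' \<le> mabs k div 2"
  shows "has_bochner_integral lborel
    (\<lambda>x. monomial_component \<mu> k m x * monomial_component \<mu> k m' x * ball_weight \<mu> x) 0"
proof (cases "m < m'")
  case True
  then show ?thesis using assms by (intro monomial_component_orthogonal_less) auto
next
  case False
  then have "has_bochner_integral lborel
    (\<lambda>x. monomial_component \<mu> k m' x * monomial_component \<mu> k m x * ball_weight \<mu> x) 0"
    using assms by (intro monomial_component_orthogonal_less) auto
  then show ?thesis by (simp add: mult_ac)
qed

text \<open>Source of the last quotient and of the prefactor in the norm formula:
  \<open>pochhammer_reflect\<close> is applied with 1/2 in each coordinate and with L+1 in the total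
  degree. The signs (-1)^|i| cancel.\<close>

lemma ball_moment_double_minus:
  fixes k i :: "'d::finite \<Rightarrow> nat"
  assumes i: "i \<in> half_le k" and L: "L > 0"
  shows "ball_moment L (\<lambda>l. k l - 2 * i l + k l)
    = mpoch (\<lambda>_. 1 / 2) k / pochhammer (L + 1) (mabs k)
      * (pochhammer (- real (mabs k) - L) (mabs i) / mpoch (\<lambda>l. - real (k l) + 1 / 2) i)"
proof -
  have ik: "2 * i l \<le> k l" for l using i by (simp add: half_le_def)
  then have ik': "i l \<le> k l" for l using ik[of l] by linarith
  have IK: "mabs i \<le> mabs k" using half_le_mabs[OF i] by linarith
  have "k l - 2 * i l + k l = 2 * (k l - i l)" for l using ik[of l] by linarith
  then have mom: "ball_moment L (\<lambda>l. k l - 2 * i l + k l)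
      = mpoch (\<lambda>_. 1 / 2) (\<lambda>l. k l - i l) / pochhammer (L + 1) (mabs k - mabs i)"
    by (simp add: ball_moment_def mabs_double mabs_diff ik')
  have "pochhammer (- real (k l) + 1 / 2) (i l) * pochhammer (1 / 2) (k l - i l)
      = (-1) ^ i l * pochhammer (1 / 2) (k l)" for l
    using pochhammer_reflect[OF ik'[of l], where L = "1 / 2"] by simp
  then have num: "mpoch (\<lambda>l. - real (k l) + 1 / 2) i * mpoch (\<lambda>_. 1 / 2) (\<lambda>l. k l - i l)
      = (-1) ^ mabs i * mpoch (\<lambda>_. 1 / 2) k"
    unfolding mpoch_def prod.distrib[symmetric] by (simp add: prod.distrib mabs_def power_sum)
  have den: "pochhammer (- real (mabs k) - L) (mabs i) * pochhammer (L + 1) (mabs k - mabs i)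
      = (-1) ^ mabs i * pochhammer (L + 1) (mabs k)"
  proof -
    have "- real (mabs k) - (L + 1) + 1 = - real (mabs k) - L" by simp
    then show ?thesis using pochhammer_reflect[OF IK, where L = "L + 1"] by (simp only:)
  qed
  have "mpoch (\<lambda>_. 1 / 2 :: real) k > 0"
    unfolding mpoch_def by (intro prod_pos) (simp add: pochhammer_pos)
  then have nz1: "mpoch (\<lambda>l. - real (k l) + 1 / 2) i \<noteq> 0" using num by auto
  have nz2: "pochhammer (L + 1) (mabs k) \<noteq> 0" "pochhammer (L + 1) (mabs k - mabs i) \<noteq> 0"
    using L by (simp_all add: pochhammer_pos_neq_0)
  have "mpoch (\<lambda>_. 1 / 2) (\<lambda>l. k l - i l) = (-1) ^ mabs i * mpoch (\<lambda>_. 1 / 2) k / mpoch (\<lambda>l. - real (k l) + 1 / 2) i"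
    unfolding num[symmetric] using nz1 by simp
  moreover have "pochhammer (- real (mabs k) - L) (mabs i)
      = (-1) ^ mabs i * pochhammer (L + 1) (mabs k) / pochhammer (L + 1) (mabs k - mabs i)"
    unfolding den[symmetric] using nz2 by simp
  ultimately show ?thesis unfolding mom using nz1 nz2 by (simp add: mult_ac)
qed

text \<open>By orthogonality, pairing a component with \<open>x\<^sup>k = \<Sum>\<^sub>m P\<^sub>m\<close> leaves only its square.\<close>

lemma has_bochner_integral_monomial_component_square:
  fixes k :: "'d::finite \<Rightarrow> nat"
  assumes \<mu>: "\<mu> > - 1 / 2" and L: "lam CARD('d) \<mu> > 0" and m: "m \<le> mabs k div 2"
  shows "has_bochner_integral lborel
    (\<lambda>x. monomial_component \<mu> k m x * monomial_component \<mu> k m x * ball_weight \<mu> x)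
    (ball_mass CARD('d) \<mu> * (\<Sum>i\<in>half_le k. B_coeff \<mu> k i m *
       ball_moment (lam CARD('d) \<mu>) (\<lambda>l. k l - 2 * i l + k l)))"
proof -
  let ?P = "monomial_component \<mu> k"
  let ?N = "ball_mass CARD('d) \<mu> * (\<Sum>i\<in>half_le k. B_coeff \<mu> k i m *
       ball_moment (lam CARD('d) \<mu>) (\<lambda>l. k l - 2 * i l + k l))"
  have "has_bochner_integral lborel (\<lambda>x. ?P m x * mpow x k * ball_weight \<mu> x) ?N"
    using has_bochner_integral_ball_mpow_sum[OF \<mu>, where A = "half_le k" and c = "\<lambda>i. B_coeff \<mu> k i m"
        and a = "\<lambda>i l. k l - 2 * i l + k l"]
    by (simp add: monomial_component_eq[OF L] sum_distrib_right mult.assoc mpow_add)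
  moreover have "has_bochner_integral lborel
      (\<lambda>x. \<Sum>m'\<in>{..mabs k div 2} - {m}. ?P m x * ?P m' x * ball_weight \<mu> x) (\<Sum>m'\<in>{..mabs k div 2} - {m}. 0)"
    using m by (intro has_bochner_integral_sum monomial_component_orthogonal \<mu> L) auto
  \<comment> \<open>The square appears as a difference of integrands already treated, so its
    integrability needs no separate argument.\<close>
  ultimately have "has_bochner_integral lborel (\<lambda>x. ?P m x * mpow x k * ball_weight \<mu> x
      - (\<Sum>m'\<in>{..mabs k div 2} - {m}. ?P m x * ?P m' x * ball_weight \<mu> x)) (?N - (\<Sum>m'\<in>{..mabs k div 2} - {m}. 0))"
    by (rule has_bochner_integral_diff)
  moreover have "?P m x * mpow x k * ball_weight \<mu> x
      - (\<Sum>m'\<in>{..mabs k div 2} - {m}. ?P m x * ?P m' x * ball_weight \<mu> x) = ?P m x * ?P m x * ball_weight \<mu> x" for x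
  proof -
    have "mpow x k = (\<Sum>m'\<le>mabs k div 2. ?P m' x)"
      by (rule sum_monomial_component[OF L, symmetric])
    also have "\<dots> = ?P m x + (\<Sum>m'\<in>{..mabs k div 2} - {m}. ?P m' x)"
      using m by (intro sum.remove) auto
    finally show ?thesis
      by (simp add: sum_distrib_left sum_distrib_right algebra_simps)
  qed
  ultimately show ?thesis by simp
qed

section \<open>Radial integrals and the final assembly\<close>

lemma weight_poly_integrable:
  assumes "is_weight d \<mu> w"
  shows "set_integrable lebesgue {0..} (\<lambda>t. t powr (real d + 2 * \<mu> - 1) * (poly p t * w t))"
proof -
  have pw: "t powr (real d + 2 * \<mu> - 1 + real j) = t powr (real d + 2 * \<mu> - 1) * t ^ j" if "t \<ge> 0" for t j
    using that by (cases "t = 0") (simp_all add: powr_add powr_realpow)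
  have "integrable lebesgue (\<lambda>t. \<Sum>j\<le>degree p. coeff p j *
      (indicator {0..} t *\<^sub>R (t powr (real d + 2 * \<mu> - 1 + real j) * w t)))"
    using assms by (intro Bochner_Integration.integrable_sum integrable_mult_right)
      (auto simp: is_weight_def set_integrable_def)
  also have "(\<lambda>t. \<Sum>j\<le>degree p. coeff p j *
      (indicator {0..} t *\<^sub>R (t powr (real d + 2 * \<mu> - 1 + real j) * w t)))
    = (\<lambda>t. indicator {0..} t *\<^sub>R (t powr (real d + 2 * \<mu> - 1) * (poly p t * w t)))"
  proof (rule ext)
    fix t :: real
    have "(\<Sum>j\<le>degree p. coeff p j * (t powr (real d + 2 * \<mu> - 1 + real j) * w t))
        = t powr (real d + 2 * \<mu> - 1) * (poly p t * w t)" if "t \<ge> 0"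
      unfolding poly_altdef sum_distrib_left sum_distrib_right pw[OF that] by (simp only: mult_ac)
    then show "(\<Sum>j\<le>degree p. coeff p j *
        (indicator {0..} t *\<^sub>R (t powr (real d + 2 * \<mu> - 1 + real j) * w t)))
      = indicator {0..} t *\<^sub>R (t powr (real d + 2 * \<mu> - 1) * (poly p t * w t))"
      by (cases "t \<ge> 0") simp_all
  qed
  finally show ?thesis unfolding set_integrable_def .
qed

theorem proposition3p4:
  fixes \<mu> :: real and w :: "real \<Rightarrow> real" and k :: "'d::finite \<Rightarrow> nat" and n :: nat
  assumes "CARD('d) \<ge> 2"
    and "\<mu> > - 1/2"
    and "is_weight CARD('d) \<mu> w"
    and "mabs k \<le> n"
  shows "b_cone TYPE('d) w \<mu> *
      (LINT p:(solid_cone :: ((real ^ 'd) \<times> real) set)|lebesgue. \<bar>V_cone w \<mu> k n p\<bar>\<^sup>2 * cone_weight w \<mu> p)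
    = mpoch (\<lambda>_. 1/2) k / pochhammer (\<mu> + (real CARD('d) + 1) / 2) (mabs k) *
      (\<Sum>i\<in>half_le k. \<Sum>m=0..mabs i.
         B_coeff \<mu> k i m *
         q_norm_sq CARD('d) w \<mu> (n - mabs k + 2 * m)
           (2 * (real (mabs k) - 2 * real m) + 2 * \<mu> + real CARD('d) - 1) *
         (pochhammer (- real (mabs k) - \<mu> - (real CARD('d) - 1) / 2) (mabs i) /
          mpoch (\<lambda>l. - real (k l) + 1/2) i))"
proof -
  define K where "K = mabs k"
  define L where "L = lam CARD('d) \<mu>"
  define a where "a = real CARD('d) + 2 * \<mu> - 1"
  define M where "M = ball_mass CARD('d) \<mu>"
  \<comment> \<open>Absorbing t^(K-2m) into the polynomial leaves the same radial weight t^a w(t)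
    for all m, so one functional \<open>R\<close> evaluates every radial integral.\<close>
  define Q where "Q m = q_poly w (n - (K - 2 * m)) (2 * real (K - 2 * m) + 2 * \<mu> + real CARD('d) - 1)
    * monom 1 (K - 2 * m)" for m
  define R where "R p = (LINT t:{0..}|lebesgue. t powr a * (poly p t * w t))" for p
  define P where "P = monomial_component \<mu> k"
  define mo where "mo i = ball_moment L (\<lambda>l. k l - 2 * i l + k l)" for i
  define N where "N m = (\<Sum>i\<in>half_le k. B_coeff \<mu> k i m * mo i)" for m
  have \<mu>: "\<mu> > - 1 / 2" using assms(2) by simp
  \<comment> \<open>The dimension bound is used here: \<mu> > -1/2 alone gives only lambda >
    (d-2)/2.\<close>
  have L0: "L > 0" using assms(1,2) by (simp add: L_def lam_def field_simps)
  have M0: "M > 0" unfolding M_def using assms(1) by (intro ball_mass_pos \<mu>) simp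
  have PP: "has_bochner_integral lborel (\<lambda>x. P m x * P m' x * ball_weight \<mu> x) (if m = m' then M * N m else 0)"
    if "m \<le> K div 2" "m' \<le> K div 2" for m m'
    using that monomial_component_orthogonal[OF \<mu>, where k = k and m = m and m' = m']
      has_bochner_integral_monomial_component_square[OF \<mu>, where k = k and m = m] L0
    by (auto simp: P_def M_def N_def mo_def L_def K_def)
  have cone: "has_bochner_integral lebesgue
    (\<lambda>(x, t). indicator solid_cone (x, t) * (poly p t * w t * F (x /\<^sub>R t) * (t\<^sup>2 - (norm x)\<^sup>2) powr (\<mu> - 1 / 2)))
    (R p * I)"
    if [measurable]: "F \<in> borel_measurable borel" and F: "has_bochner_integral lborel (\<lambda>x. F x * ball_weight \<mu> x) I"
    for p and F :: "real ^ 'd \<Rightarrow> real" and I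
    using has_bochner_integral_cone[of F \<mu> "\<lambda>t. poly p t * w t"] F weight_poly_integrable[OF assms(3), of p]
    by (simp add: has_bochner_integral_iff ball_integral_def R_def a_def)
  have Pm [measurable]: "P m \<in> borel_measurable borel" for m
    unfolding P_def monomial_component_def[abs_def] V_ball_def by measurable
  have V: "V_cone w \<mu> k n (x, t) = (\<Sum>m\<le>K div 2. poly (Q m) t * P m (x /\<^sub>R t))" for x t
    unfolding V_cone_eq by (simp add: Q_def P_def K_def poly_monom)
  have "has_bochner_integral lebesgue
    (\<lambda>p. \<Sum>m\<le>K div 2. \<Sum>m'\<le>K div 2. (\<lambda>(x, t). indicator solid_cone (x, t) *
       (poly (Q m * Q m') t * w t * (P m (x /\<^sub>R t) * P m' (x /\<^sub>R t)) * (t\<^sup>2 - (norm x)\<^sup>2) powr (\<mu> - 1 / 2))) p)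
    (\<Sum>m\<le>K div 2. \<Sum>m'\<le>K div 2. R (Q m * Q m') * (if m = m' then M * N m else 0))"
    by (intro has_bochner_integral_sum cone PP) auto
  moreover have "(\<Sum>m\<le>K div 2. \<Sum>m'\<le>K div 2. (\<lambda>(x, t). indicator solid_cone (x, t) *
       (poly (Q m * Q m') t * w t * (P m (x /\<^sub>R t) * P m' (x /\<^sub>R t)) * (t\<^sup>2 - (norm x)\<^sup>2) powr (\<mu> - 1 / 2))) p)
     = indicator solid_cone p *\<^sub>R (\<bar>V_cone w \<mu> k n p\<bar>\<^sup>2 * cone_weight w \<mu> p)" for p :: "(real ^ 'd) \<times> real"
  proof -
    obtain x t where p: "p = (x, t)" by (cases p)
    show ?thesis
      unfolding p V power2_abs power2_eq_square[of "sum _ _"] sum_product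
      by (simp add: cone_weight_def sum_distrib_left sum_distrib_right mult_ac)
  qed
  moreover have "(\<Sum>m\<le>K div 2. \<Sum>m'\<le>K div 2. R (Q m * Q m') * (if m = m' then M * N m else 0))
     = M * (\<Sum>m\<le>K div 2. R (Q m * Q m) * N m)"
    by (simp add: if_distrib[of "(*) _"] sum_distrib_left mult_ac cong: if_cong)
  ultimately have int: "(LINT p:(solid_cone :: ((real ^ 'd) \<times> real) set)|lebesgue. \<bar>V_cone w \<mu> k n p\<bar>\<^sup>2 * cone_weight w \<mu> p)
     = M * (\<Sum>m\<le>K div 2. R (Q m * Q m) * N m)"
    unfolding set_lebesgue_integral_def by (simp add: has_bochner_integral_integral_eq)
  \<comment> \<open>The case of constant functions is the total mass of the cone; it factors as
    \<open>R 1 * M\<close>, so \<open>M\<close> cancels from the norm and only the radial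
    normalization remains.\<close>
  have "has_bochner_integral lebesgue
    (\<lambda>(x :: real ^ 'd, t). indicator solid_cone (x, t) * (poly 1 t * w t * 1 * (t\<^sup>2 - (norm x)\<^sup>2) powr (\<mu> - 1 / 2)))
    (R 1 * M)"
    using cone[of "\<lambda>_. 1" M 1] has_bochner_integral_ball_weight[OF \<mu>, where 'd = 'd] by (simp add: M_def)
  moreover have "(\<lambda>(x, t). indicator solid_cone (x, t) * (poly 1 t * w t * 1 * (t\<^sup>2 - (norm x)\<^sup>2) powr (\<mu> - 1 / 2)))
     = (\<lambda>p :: (real ^ 'd) \<times> real. indicator solid_cone p *\<^sub>R cone_weight w \<mu> p)"
    by (auto simp: cone_weight_def)
  ultimately have bc: "b_cone TYPE('d) w \<mu> = inverse (R 1) * inverse M"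
    unfolding b_cone_def set_lebesgue_integral_def by (simp add: has_bochner_integral_integral_eq)
  have br: "b_radial CARD('d) w \<mu> = inverse (R 1)"
    by (simp add: b_radial_def R_def a_def)
  \<comment> \<open>The squared power t^(2(K-2m)) in \<open>Q m * Q m\<close> raises the exponent a
    to \<open>\<alpha>\<close>. The bound on m reconciles subtraction in \<open>nat\<close> with
    that in \<open>real\<close>; at t = 0 both integrands vanish because
    \<open>0 powr x = 0\<close>.\<close>
  have qn: "q_norm_sq CARD('d) w \<mu> (n - K + 2 * m) (2 * (real K - 2 * real m) + 2 * \<mu> + real CARD('d) - 1)
     = inverse (R 1) * R (Q m * Q m)" if m: "2 * m \<le> K" for m
  proof -
    define \<alpha> where "\<alpha> = 2 * (real K - 2 * real m) + 2 * \<mu> + real CARD('d) - 1"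
    have n: "n - K + 2 * m = n - (K - 2 * m)" using m assms(4) by (simp add: K_def)
    have Km: "real (K - 2 * m) = real K - 2 * real m" using m by (simp add: of_nat_diff)
    have "\<bar>poly (q_poly w (n - (K - 2 * m)) \<alpha>) t\<bar>\<^sup>2 * t powr \<alpha> * w t = t powr a * (poly (Q m * Q m) t * w t)"
      if "t \<ge> 0" for t
    proof (cases "t = 0")
      case False
      have "\<alpha> = a + real (K - 2 * m) + real (K - 2 * m)" by (simp add: \<alpha>_def a_def Km)
      then have "t powr \<alpha> = t powr a * t ^ (K - 2 * m) * t ^ (K - 2 * m)"
        using False that by (simp only: powr_add powr_realpow[of t])
      moreover have "poly (Q m) t = poly (q_poly w (n - (K - 2 * m)) \<alpha>) t * t ^ (K - 2 * m)"
        unfolding Q_def Km \<alpha>_def by (simp add: poly_monom)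
      ultimately show ?thesis
        by (simp add: power2_eq_square mult_ac)
    qed simp
    then have "(LINT t:{0..}|lebesgue. \<bar>poly (q_poly w (n - (K - 2 * m)) \<alpha>) t\<bar>\<^sup>2 * t powr \<alpha> * w t) = R (Q m * Q m)"
      unfolding R_def set_lebesgue_integral_def
      by (intro Bochner_Integration.integral_cong) (auto simp: indicator_def)
    then show ?thesis unfolding q_norm_sq_def br n \<alpha>_def[symmetric] by simp
  qed
  have mo: "mo i = mpoch (\<lambda>_. 1/2) k / pochhammer (\<mu> + (real CARD('d) + 1) / 2) K *
     (pochhammer (- real K - \<mu> - (real CARD('d) - 1) / 2) (mabs i) / mpoch (\<lambda>l. - real (k l) + 1/2) i)"
    if "i \<in> half_le k" for i
  proof -
    have 1: "L + 1 = \<mu> + (real CARD('d) + 1) / 2" by (simp add: L_def lam_def field_simps)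
    have 2: "- real K - L = - real K - \<mu> - (real CARD('d) - 1) / 2" by (simp add: L_def lam_def)
    show ?thesis
      unfolding mo_def ball_moment_double_minus[OF that L0] K_def[symmetric] 1 2 by simp
  qed
  have "b_cone TYPE('d) w \<mu> * (M * (\<Sum>m\<le>K div 2. R (Q m * Q m) * N m))
     = inverse (R 1) * (\<Sum>m\<le>K div 2. R (Q m * Q m) * N m)"
    unfolding bc using M0 by simp
  also have "\<dots> = (\<Sum>m\<le>K div 2. \<Sum>i\<in>half_le k. B_coeff \<mu> k i m * (inverse (R 1) * R (Q m * Q m)) * mo i)"
    unfolding N_def by (simp add: sum_distrib_left mult_ac)
  also have "\<dots> = (\<Sum>i\<in>half_le k. \<Sum>m\<le>K div 2. B_coeff \<mu> k i m * (inverse (R 1) * R (Q m * Q m)) * mo i)"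
    by (rule sum.swap)
  also have "\<dots> = (\<Sum>i\<in>half_le k. \<Sum>m=0..mabs i. B_coeff \<mu> k i m *
      q_norm_sq CARD('d) w \<mu> (n - K + 2 * m) (2 * (real K - 2 * real m) + 2 * \<mu> + real CARD('d) - 1) * mo i)"
  proof (rule sum.cong[OF refl])
    fix i assume i: "i \<in> half_le k"
    have I: "2 * mabs i \<le> K" using half_le_mabs[OF i] by (simp add: K_def)
    \<comment> \<open>The binomial in \<open>B_coeff\<close> vanishes for m > |i|, so the common
      range of m shrinks to the one depending on i.\<close>
    have "(\<Sum>m\<le>K div 2. B_coeff \<mu> k i m * (inverse (R 1) * R (Q m * Q m)) * mo i)
       = (\<Sum>m=0..mabs i. B_coeff \<mu> k i m * (inverse (R 1) * R (Q m * Q m)) * mo i)"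
      using I by (intro sum.mono_neutral_right) (auto simp: B_coeff_def binomial_eq_0)
    also have "\<dots> = (\<Sum>m=0..mabs i. B_coeff \<mu> k i m *
      q_norm_sq CARD('d) w \<mu> (n - K + 2 * m) (2 * (real K - 2 * real m) + 2 * \<mu> + real CARD('d) - 1) * mo i)"
    proof (rule sum.cong[OF refl])
      fix m assume "m \<in> {0..mabs i}"
      then have "2 * m \<le> K" using I by simp
      then show "B_coeff \<mu> k i m * (inverse (R 1) * R (Q m * Q m)) * mo i = B_coeff \<mu> k i m *
        q_norm_sq CARD('d) w \<mu> (n - K + 2 * m) (2 * (real K - 2 * real m) + 2 * \<mu> + real CARD('d) - 1) * mo i"
        by (simp only: qn)
    qed
    finally show "(\<Sum>m\<le>K div 2. B_coeff \<mu> k i m * (inverse (R 1) * R (Q m * Q m)) * mo i)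
       = (\<Sum>m=0..mabs i. B_coeff \<mu> k i m *
      q_norm_sq CARD('d) w \<mu> (n - K + 2 * m) (2 * (real K - 2 * real m) + 2 * \<mu> + real CARD('d) - 1) * mo i)" .
  qed
  finally show ?thesis
    unfolding int K_def[symmetric] by (simp add: mo sum_distrib_left mult_ac)
qed

end
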